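(* Fix a constant $a_0>0$. For any $R_0>2$ and $s\ge 0$, the sequence $\{u_j|_{\{|x|=R_0\}}\}_{j\ge0}$ forms a Schauder basis of $H^s_{\mathrm{sym}}(\{|x|=R_0\})$; that is, for any $f\in H^s_{\mathrm{sym}}(\{|x|=R_0\})$ there exists a unique sequence $\{a_j\}_{j=0}^\infty$ in $\mathbb R$ such that $f=\sum_{j=0}^\infty a_ju_j$ (convergence in the $H^s$ norm). Moreover, $$\sum_{j=0}^\infty a_j^2(1+j)^{2s}\le C\,\|f\|^2_{H^s(\{|x|=R_0\})},$$ where $C=C(s,R_0)$ does not depend on $f$.
   Context: Identify $x=(x_1,x_2)\in\mathbb R^2$ with $z=x_1+\mathrm i x_2$, and put $\alpha=\frac{a_0-1}{a_0+1}\in(-1,1)$. In the region $\{z:|z+\mathrm i|>1,\ |z-\mathrm i|>1\}$ (which contains the circle $\{|z|=R_0\}$ since $R_0>2$), define for integers $j\ge0$ $$\Psi_j(z)=(-1)^{\frac{j+1}{2}}\mathrm i z^j+\sum_{k=1}^\infty\alpha^k\Big[\frac{z^j}{(kz+\mathrm i)^j}-\frac{z^j}{(kz-\mathrm i)^j}\Big]\quad (j\text{ odd}),$$ $$\Psi_j(z)=(-1)^{j/2}z^j+\sum_{k=1}^\infty(-\alpha)^k\Big[\frac{z^j}{(kz+\mathrm i)^j}+\frac{z^j}{(kz-\mathrm i)^j}\Big]\quad (j\text{ even}),$$ and $u_j(x_1,x_2)=R_0^{-j}\,\mathrm{Re}\,\Psi_j(z)$. (The functions are also defined in the unit discs $|z\mp\mathrm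 i|<1$, but only their values on the circle $|x|=R_0$ matter here.) $H^s_{\mathrm{sym}}(\{|x|=R_0\})$ is the space of real-valued $H^s$ (Sobolev) functions on the circle $\{|x|=R_0\}$ that are even with respect to $x_1$. The constant $a_0$ is fixed throughout. *)

theory Defs
  imports "HOL-Analysis.Analysis"
begin

text \<open>The plane is identified with the complex numbers, so that functions on the circle
  of radius \<open>R\<close> about the origin are functions \<open>complex \<Rightarrow> real\<close> of which only the values at the
  points \<open>rcis R t\<close> are used. Elements of $L^2$ and $H^s$ are represented by functions rather
  than by classes modulo null sets; all notions below respect equality almost everywhere on
  the circle.\<close>

definition alpha :: "real \<Rightarrow> real" where
  "alpha a0 = (a0 - 1) / (a0 + 1)"

text \<open>The formulas are those for \<open>z\<close> outside the two closed discs of radius 1 about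
  \<open>\<plusminus>\<i>\<close>; inside these discs the values of this total function carry no meaning.\<close>

definition Psi :: "real \<Rightarrow> nat \<Rightarrow> complex \<Rightarrow> complex" where
  "Psi a0 j z =
    (if odd j
     then (-1) ^ ((j + 1) div 2) * \<i> * z ^ j
          + (\<Sum>k. complex_of_real (alpha a0) ^ Suc k *
                 (z ^ j / (of_nat (Suc k) * z + \<i>) ^ j - z ^ j / (of_nat (Suc k) * z - \<i>) ^ j))
     else (-1) ^ (j div 2) * z ^ j
          + (\<Sum>k. (- complex_of_real (alpha a0)) ^ Suc k *
                 (z ^ j / (of_nat (Suc k) * z + \<i>) ^ j + z ^ j / (of_nat (Suc k) * z - \<i>) ^ j)))"

definition u :: "real \<Rightarrow> real \<Rightarrow> nat \<Rightarrow> complex \<Rightarrow> real" where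
  "u a0 R j z = Re (Psi a0 j z) / R ^ j"

definition L2_circle :: "real \<Rightarrow> (complex \<Rightarrow> real) set" where
  "L2_circle R = {f.
     (\<lambda>t. f (rcis R t)) \<in> borel_measurable (lebesgue_on {0..2*pi}) \<and>
     integrable (lebesgue_on {0..2*pi}) (\<lambda>t. (f (rcis R t))\<^sup>2)}"

definition fourier_coeff :: "real \<Rightarrow> (complex \<Rightarrow> real) \<Rightarrow> int \<Rightarrow> complex" where
  "fourier_coeff R f n =
     (1 / (2*pi)) *\<^sub>R
       integral\<^sup>L (lebesgue_on {0..2*pi}) (\<lambda>t. complex_of_real (f (rcis R t)) * cis (- of_int n * t))"

text \<open>The eigenvalues of $1 - \Delta$ on the circle of radius \<open>R\<close> are $1 + (n/R)^2$; the
  norm below is the $L^2$ norm, with respect to arc length, of $(1-\Delta)^{s/2} f$.\<close>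

definition sobolev_circle :: "real \<Rightarrow> real \<Rightarrow> (complex \<Rightarrow> real) set" where
  "sobolev_circle s R = {f \<in> L2_circle R.
     (\<lambda>n::int. (1 + (of_int n / R)\<^sup>2) powr s * (cmod (fourier_coeff R f n))\<^sup>2) summable_on UNIV}"

definition sobolev_norm :: "real \<Rightarrow> real \<Rightarrow> (complex \<Rightarrow> real) \<Rightarrow> real" where
  "sobolev_norm s R f = sqrt (2 * pi * R *
     (\<Sum>\<^sub>\<infinity>n::int. (1 + (of_int n / R)\<^sup>2) powr s * (cmod (fourier_coeff R f n))\<^sup>2))"

text \<open>The reflection \<open>(x\<^sub>1, x\<^sub>2) \<mapsto> (-x\<^sub>1, x\<^sub>2)\<close> is \<open>z \<mapsto> - cnj z\<close>.\<close>

definition sobolev_sym :: "real \<Rightarrow> real \<Rightarrow> (complex \<Rightarrow> real) set" where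
  "sobolev_sym s R = {f \<in> sobolev_circle s R.
     AE t in lebesgue_on {0..2*pi}. f (- cnj (rcis R t)) = f (rcis R t)}"

definition expands_as ::
  "((complex \<Rightarrow> real) \<Rightarrow> real) \<Rightarrow> (nat \<Rightarrow> complex \<Rightarrow> real) \<Rightarrow> (complex \<Rightarrow> real) \<Rightarrow> (nat \<Rightarrow> real) \<Rightarrow> bool" where
  "expands_as N b f a \<longleftrightarrow> (\<lambda>n. N (\<lambda>z. f z - (\<Sum>j<n. a j * b j z))) \<longlonglongrightarrow> 0"

definition schauder_basis ::
  "(complex \<Rightarrow> real) set \<Rightarrow> ((complex \<Rightarrow> real) \<Rightarrow> real) \<Rightarrow> (nat \<Rightarrow> complex \<Rightarrow> real) \<Rightarrow> bool" where
  "schauder_basis V N b \<longleftrightarrow> (\<forall>j. b j \<in> V) \<and> (\<forall>f\<in>V. \<exists>!a. expands_as N b f a)"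

end

theory Submission
  imports Defs "HOL-Probability.Discrete_Topology" "HOL-Real_Asymp.Real_Asymp"
begin

text \<open>With \<open>v = \<i> / z\<close> and \<open>\<theta> = t - pi / 2\<close>, the restriction of \<open>u_j\<close> to the circle is
  \<open>cos (j \<theta>)\<close> plus a perturbation \<open>\<Sum>n. corr n j * cos (n \<theta>)\<close>, found by expanding \<open>(k \<plusminus> v)^(-j)\<close>
  in powers of \<open>v\<close>. As \<open>R > 2\<close>, the matrix \<open>corr\<close> decays like \<open>(2 / R)^(n + j)\<close>, so it maps bounded
  sequences into every weighted \<open>l^2\<close> space, and it suffices to invert \<open>I + corr\<close> on a weighted
  supremum space. There the perturbation is a contraction: for the weight \<open>1 / j\<close> the sum over \<open>j\<close> is a negative
  binomial series, and summing the result over \<open>k\<close> telescopes,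
  \<open>(\<Sum>k\<ge>1. (2k - 1)^(-n) - (2k + 1)^(-n)) = 1\<close>, which gives the bound \<open>\<bar>\<alpha>\<bar> / n\<close> for row \<open>n\<close>.\<close>

section \<open>Perturbations of the identity on weighted sequence spaces\<close>

text \<open>Index 0 is the obstacle. The weight \<open>1 / j\<close> is void there, and the diagonal
  entry \<open>1 + corr 0 0 = 1 / a0\<close> can lie arbitrarily far from 1, so
  \<open>I + corr\<close> is not a small perturbation of the identity in that coordinate. But
  \<open>u_0\<close> is constant, so column 0 has no other nonzero entry. Scaling row 0 by
  \<open>a0\<close> therefore clears column 0 of the perturbation; after that the weight at 0 occurs
  only on the right of the estimate for row 0, and choosing it large makes that row contract as
  well.

  The number 2 enters in two ways. Binomial coefficients grow like \<open>2 ^ (n + j)\<close>, which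
  fixes the decay rate \<open>2 / R\<close>. And in the row sums \<open>R\<close> is replaced by its
  worst value 2, so that the \<open>k\<close>-th series has argument \<open>1 / (2 k)\<close> and
  the neighbouring odd numbers \<open>2 k - 1\<close> and \<open>2 k + 1\<close> appear.

  The inversion is done once, without reference to \<open>s\<close>: a solution differs from its
  data by a geometrically decaying sequence, so it inherits membership and bounds for every
  \<open>s\<close>.

  Uniqueness has to cover coefficient sequences about which nothing is known beforehand; this is
  handled by applying the operator to truncations only.\<close>

definition hs_mem :: "real \<Rightarrow> (nat \<Rightarrow> real) \<Rightarrow> bool" where
  "hs_mem s a \<longleftrightarrow> summable (\<lambda>n. (a n)\<^sup>2 * (1 + real n) powr (2 * s))"

definition hs_sq :: "real \<Rightarrow> (nat \<Rightarrow> real) \<Rightarrow> real" where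
  "hs_sq s a = (\<Sum>n. (a n)\<^sup>2 * (1 + real n) powr (2 * s))"

lemma hs_sq_nonneg: "hs_mem s a \<Longrightarrow> 0 \<le> hs_sq s a"
  unfolding hs_mem_def hs_sq_def by (rule suminf_nonneg) auto

lemma hs_abs_le:
  assumes "0 \<le> s" "hs_mem s a"
  shows "\<bar>a n\<bar> \<le> sqrt (hs_sq s a)"
proof -
  have "(a n)\<^sup>2 * 1 \<le> (a n)\<^sup>2 * (1 + real n) powr (2 * s)"
    using assms(1) by (intro mult_left_mono ge_one_powr_ge_zero) auto
  also have "\<dots> \<le> hs_sq s a"
    unfolding hs_sq_def using sum_le_suminf[OF assms(2)[unfolded hs_mem_def], of "{n}"] by simp
  finally show ?thesis by (intro real_le_rsqrt) simp
qed

text \<open>Working with squares and arbitrary constants lets one comparison serve sums,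
  differences, diagonal scalings and geometric majorants; the last two take
  \<open>L = 0\<close>.\<close>

lemma hs_dominated:
  assumes mem: "hs_mem s a" "hs_mem s b"
    and le: "\<And>n. (c n)\<^sup>2 \<le> K * (a n)\<^sup>2 + L * (b n)\<^sup>2"
  shows "hs_mem s c" "hs_sq s c \<le> K * hs_sq s a + L * hs_sq s b"
proof -
  let ?w = "\<lambda>n. (1 + real n) powr (2 * s)"
  have le': "(c n)\<^sup>2 * ?w n \<le> K * ((a n)\<^sup>2 * ?w n) + L * ((b n)\<^sup>2 * ?w n)" for n
    using mult_right_mono[OF le[of n], of "?w n"] by (simp add: algebra_simps)
  have sm: "summable (\<lambda>n. K * ((a n)\<^sup>2 * ?w n) + L * ((b n)\<^sup>2 * ?w n))"
    using mem unfolding hs_mem_def by (intro summable_add summable_mult)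
  show c: "hs_mem s c"
    unfolding hs_mem_def using le' by (intro summable_comparison_test'[OF sm]) auto
  have "hs_sq s c \<le> (\<Sum>n. K * ((a n)\<^sup>2 * ?w n) + L * ((b n)\<^sup>2 * ?w n))"
    unfolding hs_sq_def using c sm le' by (intro suminf_le) (auto simp: hs_mem_def)
  also have "\<dots> = K * hs_sq s a + L * hs_sq s b"
    using mem unfolding hs_sq_def hs_mem_def
    by (simp add: suminf_add[symmetric] suminf_mult summable_mult)
  finally show "hs_sq s c \<le> K * hs_sq s a + L * hs_sq s b" .
qed

lemma square_add_le: "(x + y)\<^sup>2 \<le> 2 * x\<^sup>2 + 2 * (y::real)\<^sup>2"
  using zero_le_power2[of "x - y"] by (simp add: power2_eq_square algebra_simps)

lemma square_diff_le: "(x - y)\<^sup>2 \<le> 2 * x\<^sup>2 + 2 * (y::real)\<^sup>2"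
  using square_add_le[of x "- y"] by simp

lemmas hs_add = hs_dominated[of _ _ _ "\<lambda>n. _ n + _ n", OF _ _ square_add_le]
lemmas hs_diff = hs_dominated[of _ _ _ "\<lambda>n. _ n - _ n", OF _ _ square_diff_le]

lemma hs_mem_geometric:
  assumes "0 < q" "q < 1"
  shows "hs_mem s (\<lambda>n. q ^ n)"
proof -
  \<comment> \<open>This is the ratio of consecutive terms. Its limit \<open>q\<^sup>2\<close> lies
    strictly below \<open>q\<close>, so \<open>q\<close> itself can serve as the bound in the ratio
    test.\<close>
  have "(\<lambda>n. ((2 + real n) / (1 + real n)) powr (2 * s) * q\<^sup>2) \<longlonglongrightarrow> 1 powr (2 * s) * q\<^sup>2"
    by (intro tendsto_intros) (real_asymp, simp)
  moreover have "1 powr (2 * s) * q\<^sup>2 < q"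
    using assms by (simp add: power2_eq_square)
  ultimately have "\<forall>\<^sub>F n in sequentially. ((2 + real n) / (1 + real n)) powr (2 * s) * q\<^sup>2 < q"
    using order_tendstoD(2) by blast
  then obtain N where N: "\<And>n. n \<ge> N \<Longrightarrow> ((2 + real n) / (1 + real n)) powr (2 * s) * q\<^sup>2 < q"
    by (auto simp: eventually_sequentially)
  show ?thesis unfolding hs_mem_def
  proof (rule summable_ratio_test[OF assms(2)])
    fix n assume "n \<ge> N"
    have "(q ^ Suc n)\<^sup>2 * (1 + real (Suc n)) powr (2 * s)
        = (((2 + real n) / (1 + real n)) powr (2 * s) * q\<^sup>2) * ((q ^ n)\<^sup>2 * (1 + real n) powr (2 * s))"
      by (simp add: powr_divide power_mult_distrib add_ac)
    also have "\<dots> \<le> q * ((q ^ n)\<^sup>2 * (1 + real n) powr (2 * s))"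
      using N[OF \<open>n \<ge> N\<close>] by (intro mult_right_mono) auto
    finally show "norm ((q ^ Suc n)\<^sup>2 * (1 + real (Suc n)) powr (2 * s))
        \<le> q * norm ((q ^ n)\<^sup>2 * (1 + real n) powr (2 * s))"
      by simp
  qed
qed

section \<open>Smoothing matrices that contract a weighted supremum norm\<close>

definition mat_app :: "(nat \<Rightarrow> nat \<Rightarrow> real) \<Rightarrow> (nat \<Rightarrow> real) \<Rightarrow> nat \<Rightarrow> real" where
  "mat_app M a n = (\<Sum>j. M n j * a j)"

text \<open>\<open>schur\<close> makes \<open>M\<close> a contraction for the norm
  \<open>sup \<bar>d n\<bar> / w n\<close>. The other two conditions on \<open>w\<close> place this
  space: by \<open>w_le\<close> its elements are bounded sequences, and by \<open>pow_le_w\<close>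
  it contains the geometrically decaying sequences, hence the image under \<open>M\<close> of every
  bounded sequence.\<close>

locale contraction_matrix =
  fixes M :: "nat \<Rightarrow> nat \<Rightarrow> real" and w :: "nat \<Rightarrow> real" and A B q \<theta> :: real
  assumes decay: "\<bar>M n j\<bar> \<le> A * q ^ (n + j)"
    and q: "0 < q" "q < 1"
    and w_pos: "0 < w n" and w_le: "w n \<le> B" and pow_le_w: "q ^ n \<le> B * w n"
    and \<theta>: "0 \<le> \<theta>" "\<theta> < 1"
    and schur: "(\<Sum>j<J. \<bar>M n j\<bar> * w j) \<le> \<theta> * w n"
begin

lemma A_nonneg: "0 \<le> A"
  using decay[of 0 0] by simp

lemma B_pos: "0 < B"
  using w_pos[of 0] w_le[of 0] by linarith

text \<open>The decay of \<open>M n j\<close> in \<open>j\<close> gives convergence for merely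
  bounded \<open>a\<close>, its decay in \<open>n\<close> passes to the image: \<open>M\<close> is
  smoothing.\<close>

lemma
  assumes "\<And>j. \<bar>a j\<bar> \<le> Y"
  shows summable_mat_app: "summable (\<lambda>j. M n j * a j)"
    and abs_mat_app_le: "\<bar>mat_app M a n\<bar> \<le> A / (1 - q) * q ^ n * Y"
proof -
  have le: "norm (M n j * a j) \<le> (A * q ^ n * Y) * q ^ j" for j
  proof -
    have "\<bar>M n j\<bar> * \<bar>a j\<bar> \<le> (A * q ^ (n + j)) * Y"
      using decay assms A_nonneg q by (intro mult_mono) auto
    then show ?thesis by (simp add: abs_mult power_add algebra_simps)
  qed
  have geo: "(\<lambda>j. (A * q ^ n * Y) * q ^ j) sums ((A * q ^ n * Y) * (1 / (1 - q)))"
    using q by (intro sums_mult geometric_sums) auto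
  show "summable (\<lambda>j. M n j * a j)"
    by (rule summable_comparison_test'[OF sums_summable[OF geo] le])
  have "norm (mat_app M a n) \<le> (\<Sum>j. (A * q ^ n * Y) * q ^ j)"
    unfolding mat_app_def by (rule norm_suminf_le[OF le sums_summable[OF geo]])
  then show "\<bar>mat_app M a n\<bar> \<le> A / (1 - q) * q ^ n * Y"
    using sums_unique[OF geo] by (simp add: algebra_simps)
qed

lemma mat_app_add:
  assumes "\<And>j. \<bar>a j\<bar> \<le> Y" "\<And>j. \<bar>b j\<bar> \<le> Z"
  shows "mat_app M (\<lambda>j. a j + b j) n = mat_app M a n + mat_app M b n"
  unfolding mat_app_def
  using suminf_add[OF summable_mat_app[of a, OF assms(1)] summable_mat_app[of b, OF assms(2)]]
  by (simp add: distrib_left)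

lemma mat_app_diff:
  assumes "\<And>j. \<bar>a j\<bar> \<le> Y" "\<And>j. \<bar>b j\<bar> \<le> Z"
  shows "mat_app M (\<lambda>j. a j - b j) n = mat_app M a n - mat_app M b n"
  unfolding mat_app_def
  using suminf_diff[OF summable_mat_app[of a, OF assms(1)] summable_mat_app[of b, OF assms(2)]]
  by (simp add: right_diff_distrib)

text \<open>The Schur test for a weighted supremum norm. Since \<open>schur\<close> bounds all
  partial sums of nonnegative terms, it yields summability as well as the bound.\<close>

lemma mat_app_contracts:
  assumes "\<And>j. \<bar>d j\<bar> \<le> S * w j"
  shows "\<bar>mat_app M d n\<bar> \<le> \<theta> * S * w n"
proof -
  have S: "0 \<le> S"
    using assms[of 0] w_pos[of 0] by (smt (verit) zero_le_mult_iff)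
  have le: "norm (M n j * d j) \<le> S * (\<bar>M n j\<bar> * w j)" for j
    using mult_left_mono[OF assms[of j], of "\<bar>M n j\<bar>"] by (simp add: abs_mult algebra_simps)
  have sm: "summable (\<lambda>j. \<bar>M n j\<bar> * w j)"
    using schur
    by (intro summableI_nonneg_bounded[of _ "\<theta> * w n"])
      (auto intro!: mult_nonneg_nonneg less_imp_le[OF w_pos])
  have "norm (mat_app M d n) \<le> (\<Sum>j. S * (\<bar>M n j\<bar> * w j))"
    unfolding mat_app_def by (rule norm_suminf_le[OF le]) (intro summable_mult sm)
  also have "\<dots> = S * (\<Sum>j. \<bar>M n j\<bar> * w j)"
    by (rule suminf_mult[OF sm])
  also have "\<dots> \<le> S * (\<theta> * w n)"
    by (intro mult_left_mono suminf_le_const sm schur S)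
  finally show ?thesis by (simp add: algebra_simps)
qed

lemma weighted_bounded:
  assumes "\<And>j. \<bar>d j\<bar> \<le> S * w j"
  shows "\<bar>d j\<bar> \<le> S * B"
proof -
  have "0 \<le> S"
    using assms[of 0] w_pos[of 0] by (smt (verit) zero_le_mult_iff)
  then have "S * w j \<le> S * B"
    using w_le by (intro mult_left_mono) auto
  then show ?thesis using assms[of j] by linarith
qed

lemma mat_app_weighted_bound:
  assumes "\<And>j. \<bar>a j\<bar> \<le> Y"
  shows "\<bar>mat_app M a n\<bar> \<le> (A / (1 - q) * B * Y) * w n"
proof -
  have Y: "0 \<le> Y" using assms[of 0] by linarith
  have "\<bar>mat_app M a n\<bar> \<le> (A / (1 - q) * Y) * q ^ n"
    using abs_mat_app_le[of a Y n] assms by (simp add: algebra_simps)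
  also have "\<dots> \<le> (A / (1 - q) * Y) * (B * w n)"
    using A_nonneg q Y pow_le_w by (intro mult_left_mono) auto
  finally show ?thesis by (simp add: algebra_simps)
qed

text \<open>With \<open>T = A / (1 - q) * B\<close>, absorbing the contracted term gives
  \<open>\<bar>d\<bar> \<le> T / (1 - \<theta>) * Y * w\<close>, hence
  \<open>\<bar>a\<bar> \<le> (1 + T / (1 - \<theta>) * B) * Y\<close>; one more application of the
  smoothing bound supplies the factor \<open>A / (1 - q)\<close>.\<close>

definition res_const :: real where
  "res_const = A / (1 - q) * (1 + A / (1 - q) * B / (1 - \<theta>) * B)"

text \<open>If \<open>y = (I + M) a\<close>, then \<open>d = M a\<close> solves \<open>d = M y - M d\<close>, so that its weighted
  supremum is controlled by that of \<open>M y\<close>.\<close>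

lemma mat_app_le_image:
  assumes a: "\<And>j. \<bar>a j\<bar> \<le> X" and y: "\<And>j. \<bar>a j + mat_app M a j\<bar> \<le> Y"
  shows "\<bar>mat_app M a n\<bar> \<le> res_const * q ^ n * Y"
proof -
  define d where "d = mat_app M a"
  define T where "T = A / (1 - q) * B"
  have T: "0 \<le> T" unfolding T_def using A_nonneg q B_pos by auto
  have Y: "0 \<le> Y" using y[of 0] by linarith
  have d_w: "\<bar>d j\<bar> \<le> (T * X) * w j" for j
    unfolding d_def T_def by (rule mat_app_weighted_bound) (rule a)
  \<comment> \<open>The a priori bound \<open>X\<close> is used qualitatively: it makes the supremum
    \<open>S\<close> finite, so that \<open>\<theta> * S\<close> can be absorbed on the left, and it
    does not enter the final constant.\<close>
  have "bdd_above (range (\<lambda>j. \<bar>d j\<bar> / w j))"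
    using d_w w_pos by (intro bdd_aboveI[of _ "T * X"]) (auto simp: field_simps)
  define S where "S = (SUP j. \<bar>d j\<bar> / w j)"
  have S: "\<bar>d j\<bar> \<le> S * w j" for j
    using cSUP_upper[OF UNIV_I \<open>bdd_above _\<close>, of j] w_pos[of j] unfolding S_def
    by (simp add: field_simps)
  have d_eq: "d j = mat_app M (\<lambda>i. a i + d i) j - mat_app M d j" for j
    using mat_app_add[of a X d "S * B"] a weighted_bounded[of d, OF S] by (simp add: d_def)
  have "\<bar>d j\<bar> / w j \<le> T * Y + \<theta> * S" for j
  proof -
    have "\<bar>d j\<bar> \<le> T * Y * w j + \<theta> * S * w j"
      using d_eq[of j] mat_app_weighted_bound[of "\<lambda>i. a i + d i" Y j] y
        mat_app_contracts[of d S j, OF S] by (auto simp: d_def T_def)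
    then show ?thesis using w_pos[of j] by (simp add: field_simps)
  qed
  then have "S \<le> T * Y + \<theta> * S"
    unfolding S_def by (intro cSUP_least) auto
  then have SY: "S \<le> T / (1 - \<theta>) * Y"
    using \<theta> by (simp add: field_simps)
  have "\<bar>a j\<bar> \<le> (1 + T / (1 - \<theta>) * B) * Y" for j
  proof -
    have "\<bar>a j\<bar> \<le> Y + S * B"
      using y[of j] weighted_bounded[of d S j, OF S] unfolding d_def by linarith
    also have "\<dots> \<le> Y + T / (1 - \<theta>) * Y * B"
      using SY B_pos by (intro add_left_mono mult_right_mono) auto
    finally show ?thesis by (simp add: algebra_simps)
  qed
  from abs_mat_app_le[of a, OF this, of n] show ?thesis
    by (simp add: res_const_def T_def algebra_simps)
qed

text \<open>Banach's fixed point theorem is applied not to \<open>a\<close> but to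
  \<open>d = M a\<close>, which must solve \<open>d = M f - M d\<close>; then
  \<open>a = f - d\<close>. The data \<open>f\<close> is only bounded and need not belong to the
  weighted space, whereas \<open>M f\<close> does.\<close>

lemma exists_preimage:
  assumes f: "\<And>j. \<bar>f j\<bar> \<le> Y"
  obtains a X where "\<And>j. \<bar>a j\<bar> \<le> X" "\<And>n. a n + mat_app M a n = f n"
proof -
  define T where "T = A / (1 - q) * B"
  \<comment> \<open>Writing \<open>d = b * w\<close> turns the weighted supremum norm of
    \<open>d\<close> into the plain supremum norm of \<open>b\<close>, and the equation for
    \<open>d\<close> into \<open>b = \<Phi> b\<close>.\<close>
  define \<Phi> where "\<Phi> b n = (mat_app M f n - mat_app M (\<lambda>j. b j * w j) n) / w n"
    for b :: "nat \<Rightarrow> real" and n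
  have wb: "\<bar>b j * w j\<bar> \<le> S * w j" if "\<And>j. \<bar>b j\<bar> \<le> S" for b :: "nat \<Rightarrow> real" and S j
    using mult_right_mono[OF that[of j] less_imp_le[OF w_pos[of j]]] w_pos[of j]
    by (simp add: abs_mult)
  \<comment> \<open>On \<open>nat discrete\<close> every function is continuous, so its bounded
    continuous functions are exactly the bounded sequences, a complete metric space.\<close>
  define ev where "ev b j = apply_bcontfun b (discrete j)" for b :: "nat discrete \<Rightarrow>\<^sub>C real" and j
  have bd: "\<bar>ev b j\<bar> \<le> norm b" for b :: "nat discrete \<Rightarrow>\<^sub>C real" and j
    using norm_bounded[of b "discrete j"] by (simp add: ev_def)
  have \<Phi>_bcont: "(\<lambda>x. \<Phi> (ev b) (of_discrete x)) \<in> bcontfun" for b :: "nat discrete \<Rightarrow>\<^sub>C real"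
  proof (rule bcontfun_normI)
    show "norm (\<Phi> (ev b) (of_discrete x)) \<le> T * Y + \<theta> * norm b" for x
    proof -
      let ?n = "of_discrete x"
      have "\<bar>mat_app M f ?n - mat_app M (\<lambda>j. ev b j * w j) ?n\<bar>
          \<le> (T * Y + \<theta> * norm b) * w ?n"
        using mat_app_weighted_bound[of f Y ?n] f
          mat_app_contracts[of "\<lambda>j. ev b j * w j" "norm b" ?n] wb[of "ev b" "norm b", OF bd]
        by (simp add: T_def algebra_simps)
      then show ?thesis using w_pos[of ?n] by (simp add: \<Phi>_def abs_divide field_simps)
    qed
  qed (auto simp: continuous_on_open_vimage[OF open_UNIV] open_discrete)
  define \<Psi> where "\<Psi> b = Bcontfun (\<lambda>x. \<Phi> (ev b) (of_discrete x))" for b :: "nat discrete \<Rightarrow>\<^sub>C real"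
  have \<Psi>_apply: "apply_bcontfun (\<Psi> b) x = \<Phi> (ev b) (of_discrete x)" for b x
    unfolding \<Psi>_def using \<Phi>_bcont by (simp add: Bcontfun_inverse)
  have "dist (\<Psi> b) (\<Psi> c) \<le> \<theta> * dist b c" for b c
  proof (rule dist_bound)
    fix x :: "nat discrete"
    define n where "n = of_discrete x"
    have diff: "ev b j * w j - ev c j * w j
        = ev (b - c) j * w j" for j
      by (simp add: ev_def left_diff_distrib)
    have "mat_app M (\<lambda>j. ev (b - c) j * w j) n
        = mat_app M (\<lambda>j. ev b j * w j) n - mat_app M (\<lambda>j. ev c j * w j) n"
      using mat_app_diff[of "\<lambda>j. ev b j * w j" "norm b * B"
            "\<lambda>j. ev c j * w j" "norm c * B"]
          weighted_bounded[of "\<lambda>j. ev b j * w j", OF wb[of "ev b", OF bd]]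
          weighted_bounded[of "\<lambda>j. ev c j * w j", OF wb[of "ev c", OF bd]]
      by (simp only: diff)
    then have "\<bar>mat_app M (\<lambda>j. ev b j * w j) n - mat_app M (\<lambda>j. ev c j * w j) n\<bar>
        \<le> \<theta> * dist b c * w n"
      using mat_app_contracts[OF wb[of "ev (b - c)", OF bd], of n] by (simp add: dist_norm)
    then show "dist (apply_bcontfun (\<Psi> b) x) (apply_bcontfun (\<Psi> c) x) \<le> \<theta> * dist b c"
      using w_pos[of n] unfolding \<Psi>_apply \<Phi>_def n_def[symmetric] dist_real_def
      by (simp add: diff_divide_distrib[symmetric] abs_divide divide_le_eq abs_minus_commute)
  qed
  then obtain b where b: "\<Psi> b = b"
    using banach_fix_type[OF \<theta>, of \<Psi>] by blast
  define d where "d j = ev b j * w j" for j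
  have d: "\<bar>d j\<bar> \<le> norm b * B" for j
    unfolding d_def by (rule weighted_bounded[OF wb[OF bd]])
  have d_eq: "d n = mat_app M f n - mat_app M d n" for n
  proof -
    have "ev b n = \<Phi> (ev b) n"
      using \<Psi>_apply[of b "discrete n"] b by (simp add: ev_def discrete_inverse)
    then show ?thesis using w_pos[of n] by (simp add: d_def[abs_def] \<Phi>_def field_simps)
  qed
  show thesis
  proof (rule that)
    show "\<bar>f j - d j\<bar> \<le> Y + norm b * B" for j
      using f[of j] d[of j] by linarith
    show "f n - d n + mat_app M (\<lambda>j. f j - d j) n = f n" for n
      using mat_app_diff[of f Y d "norm b * B", OF f d] d_eq[of n] by simp
  qed
qed

text \<open>Geometric decay beats every polynomial weight. This is the passage from supremum
  estimates to the weighted \<open>l^2\<close> norms.\<close>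

lemma hs_image_of_le:
  assumes "0 \<le> s" "hs_mem s y" and d: "\<And>n. \<bar>d n\<bar> \<le> K * q ^ n * sqrt (hs_sq s y)"
  shows "hs_mem s d" "hs_sq s d \<le> (K\<^sup>2 * hs_sq s (\<lambda>n. q ^ n)) * hs_sq s y"
proof -
  have le: "(d n)\<^sup>2 \<le> (K\<^sup>2 * hs_sq s y) * (q ^ n)\<^sup>2 + 0 * (q ^ n)\<^sup>2" for n
  proof -
    have "(d n)\<^sup>2 \<le> (K * q ^ n * sqrt (hs_sq s y))\<^sup>2"
      using power_mono[OF d[of n], of 2] by simp
    then show ?thesis
      using hs_sq_nonneg[OF assms(2)] by (simp add: power_mult_distrib algebra_simps)
  qed
  note geo = hs_mem_geometric[OF q, of s]
  show "hs_mem s d" "hs_sq s d \<le> (K\<^sup>2 * hs_sq s (\<lambda>n. q ^ n)) * hs_sq s y"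
    using hs_dominated[OF geo geo le] by (simp_all add: algebra_simps)
qed

text \<open>The preimage is at first known only to be bounded; the identity
  \<open>a = f - M a\<close> then improves it, since \<open>M a\<close> decays
  geometrically.\<close>

lemma hs_surj:
  assumes "0 \<le> s" "hs_mem s f"
  obtains a where "hs_mem s a" "\<And>n. a n + mat_app M a n = f n"
proof -
  obtain a X where a: "\<And>j. \<bar>a j\<bar> \<le> X" and eq: "\<And>n. a n + mat_app M a n = f n"
    using exists_preimage[of f] hs_abs_le[OF assms] by blast
  have "hs_mem s (mat_app M a)"
    using mat_app_le_image[of a X "sqrt (hs_sq s f)"] a eq hs_abs_le[OF assms]
    by (intro hs_image_of_le(1)[OF assms]) auto
  from hs_diff(1)[OF assms(2) this] have "hs_mem s a"
    by (simp add: eq[symmetric])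
  with eq show thesis by (rule that[rotated])
qed

lemma hs_bounds:
  assumes "0 \<le> s"
  obtains C where "C > 0"
    "\<And>a. hs_mem s a \<Longrightarrow> hs_mem s (\<lambda>n. a n + mat_app M a n)"
    "\<And>a. hs_mem s a \<Longrightarrow> hs_sq s (\<lambda>n. a n + mat_app M a n) \<le> C * hs_sq s a"
    "\<And>a. hs_mem s a \<Longrightarrow> hs_sq s a \<le> C * hs_sq s (\<lambda>n. a n + mat_app M a n)"
proof -
  define W where "W = hs_sq s (\<lambda>n. q ^ n)"
  \<comment> \<open>The summands come from
    \<open>(x + y)\<^sup>2 \<le> 2 x\<^sup>2 + 2 y\<^sup>2\<close> and from bounding
    \<open>M a\<close> once by \<open>a\<close> (constant \<open>A / (1 - q)\<close>) and once by
    \<open>y = a + M a\<close> (constant \<open>res_const\<close>), so one \<open>C\<close> serves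
    both directions.\<close>
  define C where "C = 2 + 2 * ((A / (1 - q))\<^sup>2 * W) + 2 * (res_const\<^sup>2 * W)"
  have W: "0 \<le> W" unfolding W_def by (rule hs_sq_nonneg[OF hs_mem_geometric[OF q]])
  have *: "hs_mem s (\<lambda>n. a n + mat_app M a n) \<and> hs_sq s (\<lambda>n. a n + mat_app M a n) \<le> C * hs_sq s a
      \<and> hs_sq s a \<le> C * hs_sq s (\<lambda>n. a n + mat_app M a n)" if a: "hs_mem s a" for a
  proof -
    note ab = hs_abs_le[OF assms a]
    have Ma: "hs_mem s (mat_app M a)" "hs_sq s (mat_app M a) \<le> (A / (1 - q))\<^sup>2 * W * hs_sq s a"
      unfolding W_def using hs_image_of_le[OF assms a, of _ "A / (1 - q)"] abs_mat_app_le[of a, OF ab]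
      by blast+
    define y where "y = (\<lambda>n. a n + mat_app M a n)"
    have y: "hs_mem s y" "hs_sq s y \<le> 2 * hs_sq s a + 2 * hs_sq s (mat_app M a)"
      unfolding y_def by (rule hs_add[OF a Ma(1)])+
    have "\<bar>a n + mat_app M a n\<bar> \<le> sqrt (hs_sq s y)" for n
      using hs_abs_le[OF assms y(1), of n] by (simp add: y_def)
    note im = mat_app_le_image[of a, OF ab this]
    have My: "hs_sq s (mat_app M a) \<le> res_const\<^sup>2 * W * hs_sq s y"
      unfolding W_def by (rule hs_image_of_le(2)[OF assms y(1) im])
    have "hs_sq s (\<lambda>n. y n - mat_app M a n) \<le> 2 * hs_sq s y + 2 * hs_sq s (mat_app M a)"
      by (rule hs_diff(2)[OF y(1) Ma(1)])
    then have a_le: "hs_sq s a \<le> 2 * hs_sq s y + 2 * hs_sq s (mat_app M a)"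
      by (simp add: y_def)
    have nn: "0 \<le> hs_sq s a" "0 \<le> hs_sq s y" using hs_sq_nonneg a y by auto
    have "0 \<le> res_const\<^sup>2 * W * hs_sq s a" "0 \<le> (A / (1 - q))\<^sup>2 * W * hs_sq s y"
      using W nn by auto
    then have "hs_sq s y \<le> C * hs_sq s a" "hs_sq s a \<le> C * hs_sq s y"
      using y(2) Ma(2) a_le My by (auto simp: C_def distrib_right)
    with y(1) show ?thesis by (simp add: y_def)
  qed
  have "C > 0" unfolding C_def using W by (intro add_pos_nonneg) auto
  with * show thesis by (intro that[of C]) auto
qed

end

section \<open>The expansion coefficients\<close>

text \<open>The binomial series with exponent \<open>-j\<close>. Truncated subtraction does the
  right thing at \<open>j = 0\<close>: \<open>(n - 1) choose n\<close> is 0 for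
  \<open>n > 0\<close>, and at \<open>n = 0\<close> the coefficient is 1, so the series is the
  constant 1.\<close>

lemma neg_binomial_sums_complex:
  fixes z :: complex
  assumes "norm z < 1"
  shows "(\<lambda>n. of_nat ((j + n - 1) choose n) * z ^ n) sums (1 / (1 - z) ^ j)"
proof -
  have *: "(- of_nat j gchoose n) * (- z) ^ n = of_nat ((j + n - 1) choose n) * z ^ n" for n
  proof (cases "j + n = 0")
    case False
    have "(- of_nat j gchoose n) = (-1) ^ n * (of_nat (j + n - 1) gchoose n :: complex)"
    proof -
      have "(of_nat (j + n - 1) :: complex) = of_nat j + of_nat n - 1"
        using False by (subst of_nat_diff) auto
      then show ?thesis by (simp only: gbinomial_minus)
    qed
    then have "(- of_nat j gchoose n) * (- z) ^ n
        = ((-1) ^ n * (-1) ^ n) * (of_nat (j + n - 1) gchoose n) * z ^ n"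
      by (simp add: power_minus[of z])
    also have "((-1) ^ n * (-1) ^ n :: complex) = 1"
      by (simp flip: power_mult_distrib)
    finally show ?thesis by (simp add: binomial_gbinomial)
  qed auto
  have "1 - z \<noteq> 0" using assms by auto
  then have "(1 + - z) powr (- of_nat j) = 1 / (1 - z) ^ j"
    by (simp add: powr_minus powr_nat' field_simps)
  with gen_binomial_complex[of "- z" "- of_nat j"] assms show ?thesis
    by (simp add: *)
qed

lemma neg_binomial_sums_real:
  fixes x :: real
  assumes "\<bar>x\<bar> < 1"
  shows "(\<lambda>n. of_nat ((j + n - 1) choose n) * x ^ n) sums (1 / (1 - x) ^ j)"
proof -
  have "(\<lambda>n. complex_of_real (of_nat ((j + n - 1) choose n) * x ^ n)) sums complex_of_real (1 / (1 - x) ^ j)"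
    using neg_binomial_sums_complex[of "complex_of_real x" j] assms by simp
  then show ?thesis by (simp only: sums_of_real_iff)
qed

text \<open>Both sides equal \<open>(j + n - 1)! / (j! n!)\<close>, which is symmetric in
  \<open>j\<close> and \<open>n\<close>. This is the reason for the weight \<open>1 / j\<close>: it
  makes the sum over \<open>j\<close> a series with exponent \<open>-n\<close> and reproduces the
  weight \<open>1 / n\<close> in front.\<close>

lemma binomial_div_eq:
  assumes "0 < n" "0 < j"
  shows "real ((j + n - 1) choose n) / real j = real ((j + n - 1) choose j) / real n"
proof -
  obtain m i where [simp]: "n = Suc m" "j = Suc i"
    using assms gr0_implies_Suc by blast
  have "Suc i * (Suc (i + m) choose Suc i) = Suc m * (Suc (i + m) choose Suc m)"
  proof -
    have "Suc i * (Suc (i + m) choose Suc i) = Suc (i + m) * (i + m choose i)"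
      by (rule Suc_times_binomial_eq[symmetric, of "i + m" i, simplified mult.commute[of "_ choose _"]])
    also have "(i + m choose i) = (i + m choose m)"
      using binomial_symmetric[of i "i + m"] by simp
    also have "Suc (i + m) * (i + m choose m) = Suc m * (Suc (i + m) choose Suc m)"
      by (rule Suc_times_binomial_eq[of "i + m" m, simplified mult.commute[of "_ choose _"]])
    finally show ?thesis .
  qed
  then have "real (Suc i) * real (Suc (i + m) choose Suc i) = real (Suc m) * real (Suc (i + m) choose Suc m)"
    by (metis of_nat_mult)
  then show ?thesis by (simp add: field_simps)
qed

text \<open>The polylogarithm of order \<open>m\<close> at \<open>b\<close>.\<close>

definition zeta_sum :: "real \<Rightarrow> nat \<Rightarrow> real" where
  "zeta_sum b m = (\<Sum>k. b ^ Suc k / real (Suc k) ^ m)"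

text \<open>The term \<open>(-1) ^ n\<close> comes from the power of \<open>k + v\<close>, the term
  \<open>(-1) ^ j\<close> from the sign before the power of \<open>k - v\<close>; together they
  vanish unless \<open>n\<close> and \<open>j\<close> have equal parity. The sign in the argument of
  \<open>zeta_sum\<close> reflects that \<open>Psi\<close> uses \<open>\<alpha>\<close> for odd and
  \<open>-\<alpha>\<close> for even \<open>j\<close>. Of \<open>R ^ (j + n)\<close>, the part
  \<open>R ^ j\<close> is the normalisation of \<open>u\<close> and \<open>R ^ n\<close> is the size
  of \<open>v ^ n\<close>.\<close>

definition corr :: "real \<Rightarrow> real \<Rightarrow> nat \<Rightarrow> nat \<Rightarrow> real" where
  "corr \<alpha> R n j = ((-1) ^ n + (-1) ^ j) * real ((j + n - 1) choose n)
     * zeta_sum (- ((-1) ^ j) * \<alpha>) (j + n) / R ^ (j + n)"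

text \<open>Two bounds for two purposes: the termwise one keeps the dependence on \<open>m\<close>
  that the telescoping over \<open>k\<close> requires, the closed one is uniform in \<open>m\<close>
  and suffices for the decay of \<open>corr\<close>.\<close>

lemma
  assumes "\<bar>b\<bar> < 1"
  shows summable_zeta_sum: "summable (\<lambda>k. \<bar>b\<bar> ^ Suc k / real (Suc k) ^ m)"
    and summable_zeta_sum': "summable (\<lambda>k. b ^ Suc k / real (Suc k) ^ m)"
    and abs_zeta_sum_le: "\<bar>zeta_sum b m\<bar> \<le> (\<Sum>k. \<bar>b\<bar> ^ Suc k / real (Suc k) ^ m)"
    and abs_zeta_sum_le': "\<bar>zeta_sum b m\<bar> \<le> \<bar>b\<bar> / (1 - \<bar>b\<bar>)"
proof -
  have geo: "(\<lambda>k. \<bar>b\<bar> ^ Suc k) sums (\<bar>b\<bar> * (1 / (1 - \<bar>b\<bar>)))"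
    unfolding power_Suc using assms by (intro sums_mult geometric_sums) auto
  have le: "\<bar>b\<bar> ^ Suc k / real (Suc k) ^ m \<le> \<bar>b\<bar> ^ Suc k" for k
    using divide_left_mono[of 1 "real (Suc k) ^ m" "\<bar>b\<bar> ^ Suc k"] by simp
  show 1: "summable (\<lambda>k. \<bar>b\<bar> ^ Suc k / real (Suc k) ^ m)"
    by (rule summable_comparison_test'[OF sums_summable[OF geo], of 0])
      (use le in \<open>auto simp: abs_mult power_abs\<close>)
  show "summable (\<lambda>k. b ^ Suc k / real (Suc k) ^ m)"
    by (rule summable_comparison_test'[OF 1, of 0]) (simp add: abs_mult power_abs)
  show 2: "\<bar>zeta_sum b m\<bar> \<le> (\<Sum>k. \<bar>b\<bar> ^ Suc k / real (Suc k) ^ m)"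
    using norm_suminf_le[OF _ 1, of "\<lambda>k. b ^ Suc k / real (Suc k) ^ m"]
    by (simp add: zeta_sum_def abs_mult power_abs)
  also have "\<dots> \<le> (\<Sum>k. \<bar>b\<bar> ^ Suc k)"
    by (rule suminf_le[OF le 1 sums_summable[OF geo]])
  also have "\<dots> = \<bar>b\<bar> / (1 - \<bar>b\<bar>)"
    using sums_unique[OF geo] by simp
  finally show "\<bar>zeta_sum b m\<bar> \<le> \<bar>b\<bar> / (1 - \<bar>b\<bar>)" .
qed

section \<open>Decay and weighted row sums of the correction matrix\<close>

lemma abs_sign_sum: "\<bar>(-1) ^ n + (-1) ^ j\<bar> = (1 + (-1) ^ (n + j) :: real)"
  by (cases "even n"; cases "even j") auto

lemma abs_neg_one_power_mult: "\<bar>- ((-1) ^ j) * (a::real)\<bar> = \<bar>a\<bar>"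
  by (simp add: abs_mult)

text \<open>The growth of the binomial coefficients, at most \<open>2 ^ (n + j)\<close>, against
  \<open>R ^ (n + j)\<close>: the rate \<open>2 / R\<close> is below 1 exactly when
  \<open>R > 2\<close>.\<close>

lemma abs_corr_le:
  assumes "\<bar>\<alpha>\<bar> < 1" "R > 0"
  shows "\<bar>corr \<alpha> R n j\<bar> \<le> 2 * (\<bar>\<alpha>\<bar> / (1 - \<bar>\<alpha>\<bar>)) * (2 / R) ^ (n + j)"
proof -
  let ?z = "\<bar>\<alpha>\<bar> / (1 - \<bar>\<alpha>\<bar>)"
  have sgn: "(1 + (-1) ^ (n + j) :: real) \<le> 2" "0 \<le> (1 + (-1) ^ (n + j) :: real)"
    by (cases "even (n + j)"; simp)+
  have "real ((j + n - 1) choose n) \<le> 2 ^ (j + n - 1)"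
    using binomial_le_pow2[of "j + n - 1" n] by (metis of_nat_le_iff of_nat_numeral of_nat_power)
  also have "\<dots> \<le> 2 ^ (n + j)" by (intro power_increasing) auto
  finally have bin: "real ((j + n - 1) choose n) \<le> 2 ^ (n + j)" .
  have "\<bar>corr \<alpha> R n j\<bar> = (1 + (-1) ^ (n + j)) * real ((j + n - 1) choose n)
      * \<bar>zeta_sum (- ((-1) ^ j) * \<alpha>) (j + n)\<bar> / R ^ (j + n)"
    using assms by (simp add: corr_def abs_mult abs_sign_sum abs_divide)
  also have "\<dots> \<le> 2 * 2 ^ (n + j) * ?z / R ^ (j + n)"
    using sgn bin abs_zeta_sum_le'[of "- ((-1) ^ j) * \<alpha>" "j + n"] assms
    unfolding abs_neg_one_power_mult
    by (intro divide_right_mono mult_mono mult_nonneg_nonneg) auto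
  also have "\<dots> = 2 * ?z * (2 / R) ^ (n + j)"
    by (simp add: power_divide add.commute)
  finally show ?thesis .
qed

text \<open>After the binomial symmetry the parity factor splits the sum into negative binomial
  series at \<open>x\<close> and at \<open>-x\<close>. The factor \<open>x ^ n\<close> then converts
  \<open>1 - x\<close> and \<open>1 + x\<close> into \<open>1 / x - 1\<close> and
  \<open>1 / x + 1\<close>.\<close>

lemma row_sum_bound:
  fixes x :: real
  assumes "0 < x" "x < 1" "0 < n"
  shows "(\<Sum>j=1..J. (1 + (-1) ^ (n + j)) * (real ((j + n - 1) choose n) / real j) * x ^ (j + n))
    \<le> (1 / (1 / x - 1) ^ n - 1 / (1 / x + 1) ^ n) / real n"
proof -
  define t where "t j = (1 + (-1) ^ (n + j)) * real ((j + n - 1) choose j) * x ^ j" for j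
  have p: "(\<lambda>j. real ((j + n - 1) choose j) * x ^ j) sums (1 / (1 - x) ^ n)"
    using neg_binomial_sums_real[of x n] assms by (simp add: add.commute)
  have "(\<lambda>j. (-1) ^ n * (real ((j + n - 1) choose j) * (- x) ^ j)) sums ((-1) ^ n * (1 / (1 + x) ^ n))"
    using neg_binomial_sums_real[of "- x" n] assms by (intro sums_mult) (simp add: add.commute)
  moreover have "t j = real ((j + n - 1) choose j) * x ^ j
      + (-1) ^ n * (real ((j + n - 1) choose j) * (- x) ^ j)" for j
    by (simp add: t_def power_minus[of x] power_add algebra_simps)
  ultimately have t: "t sums (1 / (1 - x) ^ n + (-1) ^ n * (1 / (1 + x) ^ n))"
    using sums_add[OF p] by presburger
  have t_nonneg: "0 \<le> t j" for j
    using assms by (cases "even (n + j)") (auto simp: t_def)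
  have "{..J} = insert 0 {1..J}" by auto
  then have "(\<Sum>j=1..J. t j) = (\<Sum>j\<in>{..J}. t j) - t 0"
    by simp
  also have "(\<Sum>j\<in>{..J}. t j) \<le> 1 / (1 - x) ^ n + (-1) ^ n * (1 / (1 + x) ^ n)"
    using sum_le_suminf[OF sums_summable[OF t], of "{..J}"] t_nonneg sums_unique[OF t] by simp
  finally have le: "(\<Sum>j=1..J. t j) \<le> 1 / (1 - x) ^ n + (-1) ^ n * (1 / (1 + x) ^ n) - (1 + (-1) ^ n)"
    by (simp add: t_def)
  \<comment> \<open>The second series carries the sign \<open>(-1) ^ n\<close>, but a minus is
    wanted for all \<open>n\<close>. For even \<open>n\<close> the omitted term \<open>j = 0\<close>
    equals 2 and pays for the change of sign; for odd \<open>n\<close> that term is 0 and the sign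
    is already right.\<close>
  have "1 / (1 + x) ^ n \<le> 1" using assms by simp
  then have "(-1) ^ n * (1 / (1 + x) ^ n) - (1 + (-1) ^ n) \<le> - (1 / (1 + x) ^ n)"
    by (cases "even n") auto
  with le have le': "(\<Sum>j=1..J. t j) \<le> 1 / (1 - x) ^ n - 1 / (1 + x) ^ n" by linarith
  have "(\<Sum>j=1..J. (1 + (-1) ^ (n + j)) * (real ((j + n - 1) choose n) / real j) * x ^ (j + n))
      = (\<Sum>j=1..J. x ^ n / real n * t j)"
  proof (rule sum.cong[OF refl])
    fix j assume "j \<in> {1..J}"
    then show "(1 + (-1) ^ (n + j)) * (real ((j + n - 1) choose n) / real j) * x ^ (j + n)
        = x ^ n / real n * t j"
      using binomial_div_eq[of n j] assms by (simp add: t_def power_add)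
  qed
  also have "\<dots> = x ^ n / real n * (\<Sum>j=1..J. t j)" by (rule sum_distrib_left[symmetric])
  also have "\<dots> \<le> x ^ n / real n * (1 / (1 - x) ^ n - 1 / (1 + x) ^ n)"
    using assms by (intro mult_left_mono le') auto
  also have "\<dots> = (x ^ n / (1 - x) ^ n - x ^ n / (1 + x) ^ n) / real n"
    by (simp add: right_diff_distrib diff_divide_distrib mult.commute)
  also have "\<dots> = (1 / (1 / x - 1) ^ n - 1 / (1 / x + 1) ^ n) / real n"
  proof -
    have "1 / x - 1 = (1 - x) / x" "1 / x + 1 = (1 + x) / x"
      using assms by (auto simp: field_simps)
    then show ?thesis by (simp only: power_divide) simp
  qed
  finally show ?thesis .
qed

text \<open>The \<open>1 / n\<close> on the right is again the weight, so
  \<open>\<bar>\<alpha>\<bar>\<close> is a contraction factor, uniformly in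
  \<open>R \<ge> 2\<close>. The sum starts at \<open>j = 1\<close>, where the weight begins to make
  sense.\<close>

lemma corr_row_sum:
  assumes "\<bar>\<alpha>\<bar> < 1" "R \<ge> 2" "0 < n"
  shows "(\<Sum>j=1..J. \<bar>corr \<alpha> R n j\<bar> / real j) \<le> \<bar>\<alpha>\<bar> / real n"
proof -
  define c where "c j = (1 + (-1) ^ (n + j)) * (real ((j + n - 1) choose n) / real j)" for j
  have c: "0 \<le> c j" for j
    by (cases "even (n + j)") (auto simp: c_def)
  have "\<bar>corr \<alpha> R n j\<bar> / real j \<le> (\<Sum>k. \<bar>\<alpha>\<bar> ^ Suc k * (c j * (1 / (2 * real (Suc k))) ^ (j + n)))" for j
  proof -
    have "\<bar>corr \<alpha> R n j\<bar> / real j = c j * \<bar>zeta_sum (- ((-1) ^ j) * \<alpha>) (j + n)\<bar> / R ^ (j + n)"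
      using assms by (simp add: corr_def abs_mult abs_sign_sum abs_divide c_def)
    \<comment> \<open>Here \<open>R\<close> is lowered to 2, so that the powers combine to those of
      \<open>1 / (2 * Suc k)\<close>.\<close>
    also have "\<dots> \<le> c j * (\<Sum>k. \<bar>\<alpha>\<bar> ^ Suc k / real (Suc k) ^ (j + n)) / 2 ^ (j + n)"
      using abs_zeta_sum_le[of "- ((-1) ^ j) * \<alpha>" "j + n"] assms c
      unfolding abs_neg_one_power_mult
      by (intro frac_le mult_left_mono power_mono mult_nonneg_nonneg suminf_nonneg
          summable_zeta_sum) auto
    also have "\<dots> = c j / 2 ^ (j + n) * (\<Sum>k. \<bar>\<alpha>\<bar> ^ Suc k / real (Suc k) ^ (j + n))"
      by simp
    also have "\<dots> = (\<Sum>k. c j / 2 ^ (j + n) * (\<bar>\<alpha>\<bar> ^ Suc k / real (Suc k) ^ (j + n)))"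
      by (intro suminf_mult[symmetric] summable_zeta_sum assms)
    also have "\<dots> = (\<Sum>k. \<bar>\<alpha>\<bar> ^ Suc k * (c j * (1 / (2 * real (Suc k))) ^ (j + n)))"
      by (intro suminf_cong) (simp add: power_divide power_mult_distrib mult_ac del: of_nat_Suc power_Suc)
    finally show ?thesis .
  qed
  then have "(\<Sum>j=1..J. \<bar>corr \<alpha> R n j\<bar> / real j)
      \<le> (\<Sum>j=1..J. \<Sum>k. \<bar>\<alpha>\<bar> ^ Suc k * (c j * (1 / (2 * real (Suc k))) ^ (j + n)))"
    by (intro sum_mono)
  also have "\<dots> = (\<Sum>k. \<Sum>j=1..J. \<bar>\<alpha>\<bar> ^ Suc k * (c j * (1 / (2 * real (Suc k))) ^ (j + n)))"
  proof (rule suminf_sum[symmetric])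
    fix j
    have "summable (\<lambda>k. c j / 2 ^ (j + n) * (\<bar>\<alpha>\<bar> ^ Suc k / real (Suc k) ^ (j + n)))"
      by (intro summable_mult summable_zeta_sum assms)
    then show "summable (\<lambda>k. \<bar>\<alpha>\<bar> ^ Suc k * (c j * (1 / (2 * real (Suc k))) ^ (j + n)))"
      by (simp add: power_divide power_mult_distrib mult_ac del: of_nat_Suc power_Suc)
  qed
  also have "\<dots> \<le> \<bar>\<alpha>\<bar> / real n"
  proof -
    define f where "f k = \<bar>\<alpha>\<bar> / real n * (1 / (2 * real k + 1) ^ n)" for k
    have "(\<lambda>k. 1 / (2 * real k + 1) ^ n) \<longlonglongrightarrow> 0"
      using assms(3) by real_asymp
    then have "f \<longlonglongrightarrow> \<bar>\<alpha>\<bar> / real n * 0"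
      unfolding f_def by (intro tendsto_intros)
    from telescope_sums'[OF this] have f: "(\<lambda>k. f k - f (Suc k)) sums (\<bar>\<alpha>\<bar> / real n)"
      by (simp add: f_def)
    have le: "(\<Sum>j=1..J. \<bar>\<alpha>\<bar> ^ Suc k * (c j * (1 / (2 * real (Suc k))) ^ (j + n))) \<le> f k - f (Suc k)" for k
    proof -
      define x where "x = 1 / (2 * real (Suc k))"
      have x: "0 < x" "x < 1" "1 / x - 1 = 2 * real k + 1" "1 / x + 1 = 2 * real (Suc k) + 1"
        by (auto simp: x_def field_simps)
      have row: "(\<Sum>j=1..J. c j * x ^ (j + n)) \<le> (1 / (2 * real k + 1) ^ n - 1 / (2 * real (Suc k) + 1) ^ n) / real n"
        using row_sum_bound[OF x(1,2) assms(3), of J] unfolding x(3,4) by (simp add: c_def)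
      have nn: "0 \<le> (\<Sum>j=1..J. c j * x ^ (j + n))"
        using c x by (intro sum_nonneg) auto
      have "(\<Sum>j=1..J. \<bar>\<alpha>\<bar> ^ Suc k * (c j * x ^ (j + n))) = \<bar>\<alpha>\<bar> ^ Suc k * (\<Sum>j=1..J. c j * x ^ (j + n))"
        by (rule sum_distrib_left[symmetric])
      \<comment> \<open>The telescoping differences are summable by themselves, so the powers of
        \<open>\<bar>\<alpha>\<bar>\<close> may be given up except for one factor, the one that
        makes the row contract.\<close>
      also have "\<dots> \<le> \<bar>\<alpha>\<bar> * (\<Sum>j=1..J. c j * x ^ (j + n))"
        using assms(1) nn power_le_one[of "\<bar>\<alpha>\<bar>" k]
        by (intro mult_right_mono) (auto intro!: mult_left_le)
      also have "\<dots> \<le> \<bar>\<alpha>\<bar> * ((1 / (2 * real k + 1) ^ n - 1 / (2 * real (Suc k) + 1) ^ n) / real n)"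
        by (intro mult_left_mono row) auto
      finally show ?thesis by (simp add: x_def f_def algebra_simps diff_divide_distrib)
    qed
    have sm: "summable (\<lambda>k. \<Sum>j=1..J. \<bar>\<alpha>\<bar> ^ Suc k * (c j * (1 / (2 * real (Suc k))) ^ (j + n)))"
      using c by (intro summable_comparison_test'[OF sums_summable[OF f], of 0])
        (use le in \<open>auto simp: sum_nonneg\<close>)
    show ?thesis
      using suminf_le[OF le sm sums_summable[OF f]] sums_unique[OF f] by simp
  qed
  finally show ?thesis .
qed

text \<open>\<open>(n - 1) choose n\<close> is 0. Analytically, \<open>Psi\<close> at
  \<open>j = 0\<close> is constant.\<close>

lemma corr_0_right:
  assumes "0 < n" shows "corr \<alpha> R n 0 = 0"
  using assms by (simp add: corr_def)

lemma corr_0_0: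
  assumes "\<bar>\<alpha>\<bar> < 1" shows "1 + corr \<alpha> R 0 0 = (1 - \<alpha>) / (1 + \<alpha>)"
proof -
  have "(\<lambda>k. (- \<alpha>) * (- \<alpha>) ^ k) sums ((- \<alpha>) * (1 / (1 - (- \<alpha>))))"
    using assms by (intro sums_mult geometric_sums) auto
  then have "zeta_sum (- \<alpha>) 0 = - \<alpha> / (1 + \<alpha>)"
    unfolding zeta_sum_def by (simp add: sums_unique[symmetric])
  then show ?thesis using assms by (simp add: corr_def field_simps)
qed

section \<open>Cosine expansion on the circle\<close>

text \<open>A product majorant makes the double family absolutely summable; the exchange is then
  made among unordered sums, which may be grouped by rows or by columns.\<close>

lemma sums_swap_dominated:
  fixes F :: "nat \<Rightarrow> nat \<Rightarrow> 'a :: banach"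
  assumes le: "\<And>k n. norm (F k n) \<le> G k * H n" and G: "summable G" and H: "summable H"
    and nonneg: "\<And>k. 0 \<le> G k" "\<And>n. 0 \<le> H n"
  shows "(\<lambda>n. \<Sum>k. F k n) sums (\<Sum>k. \<Sum>n. F k n)"
proof -
  have GH: "(\<lambda>(k, n). G k * H n) summable_on UNIV \<times> UNIV"
  proof (rule summable_on_SigmaI[where g = "\<lambda>k. G k * suminf H"])
    show "((\<lambda>n. case (k, n) of (k, n) \<Rightarrow> G k * H n) has_sum G k * suminf H) UNIV" for k
      using nonneg H by (auto intro!: sums_nonneg_imp_has_sum sums_mult summable_sums)
    have "summable (\<lambda>k. G k * suminf H)" by (intro summable_mult2 G)
    then show "(\<lambda>k. G k * suminf H) summable_on UNIV"
      using nonneg suminf_nonneg[OF H] by (intro norm_summable_imp_summable_on) simp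
  qed (use nonneg in auto)
  have "(\<lambda>(k, n). F k n) abs_summable_on UNIV \<times> UNIV"
  proof (rule Infinite_Sum.abs_summable_on_comparison_test'[OF GH])
    show "norm (case z of (k, n) \<Rightarrow> F k n) \<le> (case z of (k, n) \<Rightarrow> G k * H n)" for z
      using le by (cases z) auto
  qed
  then have "(\<lambda>(k, n). F k n) summable_on UNIV \<times> UNIV"
    by (rule abs_summable_summable)
  then obtain S where S: "((\<lambda>(k, n). F k n) has_sum S) (UNIV \<times> UNIV)"
    by (auto simp: summable_on_def)
  have row: "summable (\<lambda>n. norm (F k n))" for k
    by (rule summable_comparison_test'[OF summable_mult[OF H, of "G k"], of 0]) (use le in auto)
  have col: "summable (\<lambda>k. norm (F k n))" for n
    by (rule summable_comparison_test'[OF summable_mult2[OF G, of "H n"], of 0]) (use le in auto)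
  have "((\<lambda>k. \<Sum>n. F k n) has_sum S) UNIV"
  proof (rule has_sum_SigmaD[OF S])
    show "((\<lambda>n. case (k, n) of (k, n) \<Rightarrow> F k n) has_sum (\<Sum>n. F k n)) UNIV" for k
      using norm_summable_imp_has_sum[OF row[of k]] summable_sums[OF summable_norm_cancel[OF row[of k]]]
      by simp
  qed
  then have "(\<Sum>k. \<Sum>n. F k n) = S"
    using has_sum_imp_sums sums_unique by metis
  moreover have "((\<lambda>(n, k). F k n) has_sum S) (UNIV \<times> UNIV)"
    using S by (subst (asm) has_sum_swap) (simp add: case_prod_unfold)
  then have "((\<lambda>n. \<Sum>k. F k n) has_sum S) UNIV"
  proof (rule has_sum_SigmaD)
    show "((\<lambda>k. case (n, k) of (n, k) \<Rightarrow> F k n) has_sum (\<Sum>k. F k n)) UNIV" for n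
      using norm_summable_imp_has_sum[OF col[of n]] summable_sums[OF summable_norm_cancel[OF col[of n]]]
      by simp
  qed
  ultimately show ?thesis
    using has_sum_imp_sums by metis
qed

text \<open>Factor out \<open>K = Suc k\<close> and expand in \<open>v / K\<close> and
  \<open>- v / K\<close>. The free parameter \<open>\<epsilon>\<close> covers the even and the odd
  form of \<open>Psi\<close> at once.\<close>

lemma inverse_power_expansion:
  fixes v :: complex
  assumes "norm v < 1"
  shows "(\<lambda>n. of_nat ((j + n - 1) choose n) * ((- 1) ^ n + \<epsilon>) * v ^ n / of_nat (Suc k) ^ (j + n))
    sums (1 / (of_nat (Suc k) + v) ^ j + \<epsilon> * (1 / (of_nat (Suc k) - v) ^ j))"
proof -
  define K :: complex where "K = of_nat (Suc k)"
  have K: "K \<noteq> 0" unfolding K_def by (simp del: of_nat_Suc)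
  have "norm K \<ge> 1" unfolding K_def norm_of_nat by simp
  then have "norm (v / K) < 1" "norm (- v / K) < 1"
    using assms by (auto simp: norm_divide divide_less_eq)
  note s = this[THEN neg_binomial_sums_complex, of j]
  have eq: "1 / K ^ j * (1 / (1 - - v / K) ^ j) = 1 / (K + v) ^ j"
    "\<epsilon> / K ^ j * (1 / (1 - v / K) ^ j) = \<epsilon> * (1 / (K - v) ^ j)"
    using K by (auto simp flip: power_mult_distrib simp: field_simps)
  have sm: "(\<lambda>n. 1 / K ^ j * (of_nat ((j + n - 1) choose n) * (- v / K) ^ n)
      + \<epsilon> / K ^ j * (of_nat ((j + n - 1) choose n) * (v / K) ^ n))
      sums (1 / (K + v) ^ j + \<epsilon> * (1 / (K - v) ^ j))"
    unfolding eq[symmetric] by (intro sums_add sums_mult s)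
  have pm: "(- (v / K)) ^ n = (- 1) ^ n * v ^ n / K ^ n" for n
    by (simp add: power_minus[of "v / K"] power_divide)
  have "(\<lambda>n. 1 / K ^ j * (of_nat ((j + n - 1) choose n) * (- v / K) ^ n)
      + \<epsilon> / K ^ j * (of_nat ((j + n - 1) choose n) * (v / K) ^ n))
      = (\<lambda>n. of_nat ((j + n - 1) choose n) * ((- 1) ^ n + \<epsilon>) * v ^ n / K ^ (j + n))"
    using K by (auto simp: fun_eq_iff pm power_divide power_add field_simps)
  with sm show ?thesis unfolding K_def[symmetric] by (simp only:)
qed

lemma abs_alpha_less_1: "a0 > 0 \<Longrightarrow> \<bar>alpha a0\<bar> < 1"
  by (auto simp: alpha_def abs_if field_simps)

text \<open>A single formula for both parities: \<open>inverse v = - \<i> * z\<close>, and the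
  powers of \<open>- \<i>\<close> produce precisely the leading signs in the definition, including
  the extra factor \<open>\<i>\<close> for odd \<open>j\<close>.\<close>

lemma Psi_inverse:
  assumes "z \<noteq> 0"
  defines "v \<equiv> \<i> / z"
  shows "Psi a0 j z = inverse v ^ j
    + (\<Sum>k. complex_of_real (- ((-1) ^ j) * alpha a0) ^ Suc k
        * (1 / (of_nat (Suc k) + v) ^ j + (-1) ^ j * (1 / (of_nat (Suc k) - v) ^ j)))"
proof -
  have frac: "z ^ j / (of_nat (Suc k) * z + \<i>) ^ j = 1 / (of_nat (Suc k) + v) ^ j"
    "z ^ j / (of_nat (Suc k) * z - \<i>) ^ j = 1 / (of_nat (Suc k) - v) ^ j" for k
  proof -
    have "of_nat (Suc k) * z + \<i> = z * (of_nat (Suc k) + v)" "of_nat (Suc k) * z - \<i> = z * (of_nat (Suc k) - v)"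
      using assms by (auto simp: field_simps)
    then show "z ^ j / (of_nat (Suc k) * z + \<i>) ^ j = 1 / (of_nat (Suc k) + v) ^ j"
      "z ^ j / (of_nat (Suc k) * z - \<i>) ^ j = 1 / (of_nat (Suc k) - v) ^ j"
      using assms by (simp_all only: power_mult_distrib) auto
  qed
  have inv: "inverse v = - \<i> * z"
    using assms by (simp add: field_simps)
  show ?thesis
  proof (cases "even j")
    case True
    then obtain m where m: "j = 2 * m" by blast
    have "(- \<i>) ^ (2 * m) = (-1) ^ m" by (simp add: power_mult)
    then show ?thesis
      unfolding Psi_def frac inv using True by (simp add: m power_mult_distrib)
  next
    case False
    then obtain m where m: "j = 2 * m + 1" using oddE by blast
    have "(- \<i>) ^ (2 * m) = (-1) ^ m" by (simp add: power_mult)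
    then show ?thesis
      unfolding Psi_def frac inv using False by (simp add: m power_mult_distrib)
  qed
qed

text \<open>On the circle \<open>v\<close> is \<open>cis (- \<theta>) / R\<close> with
  \<open>\<theta> = t - pi / 2\<close>, and the expansion in powers of \<open>v\<close> has real
  coefficients. Real parts therefore produce cosines only, and the leading term
  \<open>inverse v ^ j\<close> becomes \<open>R ^ j * cos (j * \<theta>)\<close>.\<close>

lemma u_cos_expansion:
  assumes "a0 > 0" "R > 2"
  shows "(\<lambda>n. corr (alpha a0) R n j * cos (real n * (t - pi / 2))) sums
    (u a0 R j (rcis R t) - cos (real j * (t - pi / 2)))"
proof -
  define z where "z = rcis R t"
  define v where "v = \<i> / z"
  define \<epsilon> :: real where "\<epsilon> = (-1) ^ j"
  define b where "b = - \<epsilon> * alpha a0"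
  have z: "z \<noteq> 0" using assms by (simp add: z_def)
  have v: "v = of_real (1 / R) * cis (- (t - pi / 2))"
  proof -
    have "cis t = \<i> * cis (t - pi / 2)"
      using cis_mult[of "pi / 2" "t - pi / 2"] by simp
    then show ?thesis
      unfolding cis_inverse[symmetric] using assms
      by (simp add: v_def z_def rcis_def field_simps del: cis_inverse)
  qed
  have norm_v: "norm v = 1 / R" using assms by (simp add: v norm_divide)
  have b: "\<bar>b\<bar> < 1"
    using abs_alpha_less_1[OF assms(1)] by (simp add: b_def \<epsilon>_def abs_mult)
  define F where "F k n = complex_of_real b ^ Suc k
    * (of_nat ((j + n - 1) choose n) * ((- 1) ^ n + of_real \<epsilon>) * v ^ n / of_nat (Suc k) ^ (j + n))" for k n
  have F_row: "(\<Sum>n. F k n) = complex_of_real b ^ Suc k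
      * (1 / (of_nat (Suc k) + v) ^ j + of_real \<epsilon> * (1 / (of_nat (Suc k) - v) ^ j))" for k
    unfolding F_def using norm_v assms
    by (intro sums_unique[symmetric] sums_mult inverse_power_expansion) auto
  have F_col: "(\<Sum>k. F k n) = of_real (corr (alpha a0) R n j * R ^ j) * cis (- (real n * (t - pi / 2)))" for n
  proof -
    have cp: "cis (- (t - pi / 2)) ^ n = cis (- (real n * (t - pi / 2)))"
      by (simp only: Complex.DeMoivre mult_minus_right)
    define c where "c = of_nat ((j + n - 1) choose n) * ((- 1) ^ n + complex_of_real \<epsilon>) * v ^ n"
    have "summable (\<lambda>k. b ^ Suc k / real (Suc k) ^ (j + n))"
      by (rule summable_zeta_sum'[OF b])
    then have "(\<lambda>k. complex_of_real (b ^ Suc k / real (Suc k) ^ (j + n))) sums of_real (zeta_sum b (j + n))"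
      unfolding zeta_sum_def sums_of_real_iff by (rule summable_sums)
    from sums_mult[OF this, of c] have "(\<lambda>k. F k n) sums (c * of_real (zeta_sum b (j + n)))"
      by (simp add: F_def c_def mult_ac del: of_nat_Suc power_Suc)
    then have "(\<Sum>k. F k n) = c * of_real (zeta_sum b (j + n))" by (rule sums_unique[symmetric])
    also have "c = of_nat ((j + n - 1) choose n) * ((- 1) ^ n + complex_of_real \<epsilon>) * of_real (1 / R ^ n)
        * cis (- (real n * (t - pi / 2)))"
      unfolding c_def v power_mult_distrib cp by (simp add: power_divide)
    finally show ?thesis
      using assms by (simp add: corr_def b_def \<epsilon>_def power_add)
  qed
  have "(\<lambda>n. \<Sum>k. F k n) sums (\<Sum>k. \<Sum>n. F k n)"
  proof (rule sums_swap_dominated)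
    \<comment> \<open>The 2 bounds the sum of two signs; the denominators
      \<open>Suc k ^ (j + n)\<close> are at least 1 and are dropped. \<open>?H\<close> is a negative
      binomial series at \<open>1 / R\<close>.\<close>
    let ?G = "\<lambda>k. 2 * \<bar>b\<bar> ^ Suc k" and ?H = "\<lambda>n. real ((j + n - 1) choose n) * (1 / R) ^ n"
    show "norm (F k n) \<le> ?G k * ?H n" for k n
    proof -
      have "norm ((-1) ^ n + complex_of_real \<epsilon>) \<le> norm ((-1) ^ n :: complex) + norm (complex_of_real \<epsilon>)"
        by (rule norm_triangle_ineq)
      then have 2: "norm ((-1) ^ n + complex_of_real \<epsilon>) \<le> 2"
        by (simp add: \<epsilon>_def norm_power)
      have "1 \<le> real (Suc k) ^ (j + n)" by (intro one_le_power) simp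
      then have "norm (F k n) \<le> \<bar>b\<bar> ^ Suc k * (real ((j + n - 1) choose n) * 2 * (1 / R) ^ n / 1)"
        unfolding F_def norm_mult norm_divide norm_power norm_of_real norm_of_nat norm_v using 2 assms
        by (intro mult_left_mono frac_le mult_right_mono) auto
      then show ?thesis by (simp add: mult_ac)
    qed
    show "summable ?G" using b by (intro summable_mult) (simp add: summable_Suc_iff)
    show "summable ?H"
      using assms by (intro sums_summable[OF neg_binomial_sums_real]) auto
  qed (use assms in auto)
  also have "(\<Sum>k. \<Sum>n. F k n) = Psi a0 j z - inverse v ^ j"
    unfolding F_row Psi_inverse[OF z] by (simp add: b_def \<epsilon>_def v_def)
  also have "inverse v ^ j = of_real (R ^ j) * cis (real j * (t - pi / 2))"
  proof -
    have "inverse v = of_real R * cis (t - pi / 2)"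
      unfolding v inverse_mult_distrib cis_inverse by simp
    then show ?thesis by (simp only: power_mult_distrib Complex.DeMoivre of_real_power)
  qed
  finally have "(\<lambda>n. Re (\<Sum>k. F k n) / R ^ j) sums
      (Re (Psi a0 j z - of_real (R ^ j) * cis (real j * (t - pi / 2))) / R ^ j)"
    by (intro sums_divide sums_Re)
  then show ?thesis
    using assms by (simp add: F_col u_def z_def diff_divide_distrib)
qed

section \<open>Cosine coefficients of symmetric functions\<close>

abbreviation circ :: "real measure" where
  "circ \<equiv> lebesgue_on {0..2 * pi}"

text \<open>The angle is measured from the imaginary axis: the reflection sends \<open>t\<close> to
  \<open>pi - t\<close>, hence \<open>t - pi / 2\<close> to its negative, and symmetric functions
  become even ones.\<close>

definition cosine_coeff :: "real \<Rightarrow> (complex \<Rightarrow> real) \<Rightarrow> nat \<Rightarrow> real" where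
  "cosine_coeff R f n = (if n = 0 then 1 else 2) / (2 * pi)
     * (LINT t|circ. f (rcis R t) * cos (real n * (t - pi / 2)))"

definition refl_sym :: "real \<Rightarrow> (complex \<Rightarrow> real) \<Rightarrow> bool" where
  "refl_sym R f \<longleftrightarrow> (AE t in circ. f (- cnj (rcis R t)) = f (rcis R t))"

lemma minus_cnj_rcis: "- cnj (rcis R t) = rcis R (pi - t)"
  by (simp add: complex_eq_iff)

lemma finite_circ: "finite_measure circ"
  by (rule finite_measure_lebesgue_on) simp

lemma continuous_measurable_circ:
  fixes g :: "real \<Rightarrow> real"
  assumes "continuous_on UNIV g"
  shows "g \<in> borel_measurable circ"
  by (rule continuous_imp_measurable_on_sets_lebesgue) (auto intro: continuous_on_subset[OF assms])

lemma integrable_circ_bounded: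
  fixes g :: "real \<Rightarrow> real"
  assumes "g \<in> borel_measurable circ" "\<And>t. \<bar>g t\<bar> \<le> B"
  shows "integrable circ g"
  by (rule finite_measure.integrable_const_bound[OF finite_circ, of _ B]) (use assms in auto)

lemma L2_integrable_mult:
  fixes g :: "real \<Rightarrow> real"
  assumes f: "f \<in> L2_circle R" and g: "continuous_on UNIV g" "\<And>t. \<bar>g t\<bar> \<le> 1"
  shows "integrable circ (\<lambda>t. f (rcis R t) * g t)"
proof (rule Bochner_Integration.integrable_bound)
  have [measurable]: "(\<lambda>t. f (rcis R t)) \<in> borel_measurable circ" "g \<in> borel_measurable circ"
    using f continuous_measurable_circ[OF g(1)] by (auto simp: L2_circle_def)
  show "(\<lambda>t. f (rcis R t) * g t) \<in> borel_measurable circ" by measurable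
  have "integrable circ (\<lambda>t. 1 :: real)" by (rule integrable_circ_bounded[of _ 1]) auto
  then show "integrable circ (\<lambda>t. 1 + (f (rcis R t))\<^sup>2)"
    using f by (auto simp: L2_circle_def)
  show "AE t in circ. norm (f (rcis R t) * g t) \<le> norm (1 + (f (rcis R t))\<^sup>2)"
  proof (rule AE_I2)
    fix t
    let ?x = "\<bar>f (rcis R t)\<bar>"
    have "?x * \<bar>g t\<bar> \<le> ?x * 1" by (intro mult_left_mono g) auto
    also have "\<dots> \<le> 1 + ?x\<^sup>2" using zero_le_power2[of "?x - 1/2"] by (simp add: power2_eq_square algebra_simps)
    finally show "norm (f (rcis R t) * g t) \<le> norm (1 + (f (rcis R t))\<^sup>2)"
      by (simp add: abs_mult)
  qed
qed

lemma L2_circle_linear: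
  assumes "f \<in> L2_circle R" "g \<in> L2_circle R"
  shows "(\<lambda>z. f z - c * g z) \<in> L2_circle R"
proof -
  have [measurable]: "(\<lambda>t. f (rcis R t)) \<in> borel_measurable circ" "(\<lambda>t. g (rcis R t)) \<in> borel_measurable circ"
    using assms by (auto simp: L2_circle_def)
  have "integrable circ (\<lambda>t. (f (rcis R t) - c * g (rcis R t))\<^sup>2)"
  proof (rule Bochner_Integration.integrable_bound)
    show "integrable circ (\<lambda>t. 2 * (f (rcis R t))\<^sup>2 + 2 * c\<^sup>2 * (g (rcis R t))\<^sup>2)"
      using assms by (auto simp: L2_circle_def)
    show "AE t in circ. norm ((f (rcis R t) - c * g (rcis R t))\<^sup>2)
        \<le> norm (2 * (f (rcis R t))\<^sup>2 + 2 * c\<^sup>2 * (g (rcis R t))\<^sup>2)"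
    proof (rule AE_I2)
      show "norm ((f (rcis R t) - c * g (rcis R t))\<^sup>2)
          \<le> norm (2 * (f (rcis R t))\<^sup>2 + 2 * c\<^sup>2 * (g (rcis R t))\<^sup>2)" for t
        using square_diff_le[of "f (rcis R t)" "c * g (rcis R t)"] by (simp add: power_mult_distrib)
    qed
  qed measurable
  then show ?thesis by (simp add: L2_circle_def)
qed

lemma cosine_coeff_linear:
  assumes "f \<in> L2_circle R" "g \<in> L2_circle R"
  shows "cosine_coeff R (\<lambda>z. f z - c * g z) n = cosine_coeff R f n - c * cosine_coeff R g n"
proof -
  have c: "continuous_on UNIV (\<lambda>t. cos (real n * (t - pi / 2)))" by (intro continuous_intros)
  note i = assms[THEN L2_integrable_mult, OF c abs_cos_le_one]
  have "(LINT t|circ. (f (rcis R t) - c * g (rcis R t)) * cos (real n * (t - pi / 2)))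
      = (LINT t|circ. f (rcis R t) * cos (real n * (t - pi / 2)) - c * (g (rcis R t) * cos (real n * (t - pi / 2))))"
    by (simp add: algebra_simps)
  also have "\<dots> = (LINT t|circ. f (rcis R t) * cos (real n * (t - pi / 2)))
      - c * (LINT t|circ. g (rcis R t) * cos (real n * (t - pi / 2)))"
    using i by simp
  finally have eq: "(LINT t|circ. (f (rcis R t) - c * g (rcis R t)) * cos (real n * (t - pi / 2)))
      = (LINT t|circ. f (rcis R t) * cos (real n * (t - pi / 2)))
      - c * (LINT t|circ. g (rcis R t) * cos (real n * (t - pi / 2)))" .
  show ?thesis unfolding cosine_coeff_def eq by algebra
qed

section \<open>Vanishing of the sine coefficients under the reflection\<close>

lemma has_integral_reflect_interval:
  fixes h :: "real \<Rightarrow> real"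
  assumes "(h has_integral i) {a..b}"
  shows "((\<lambda>t. h (a + b - t)) has_integral i) {a..b}"
proof -
  have "((\<lambda>x. h ((- 1) *\<^sub>R x + (a + b))) has_integral (1 / \<bar>- 1\<bar> ^ DIM(real)) *\<^sub>R i)
      ((\<lambda>x. (1 / (- 1)) *\<^sub>R x + - ((1 / (- 1)) *\<^sub>R (a + b))) ` cbox a b)"
    using assms by (intro has_integral_affinity) auto
  moreover have "(\<lambda>x. (1 / (- 1)) *\<^sub>R x + - ((1 / (- 1)) *\<^sub>R (a + b))) ` cbox a b = {a..b}"
  proof -
    have "(\<lambda>x. a + b - x) ` {a..b} = {a..b}"
      by (auto simp: image_iff intro!: bexI[of _ "a + b - x" for x])
    then show ?thesis by (simp add: algebra_simps)
  qed
  ultimately show ?thesis by (simp add: algebra_simps)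
qed

lemma has_integral_antisymmetric:
  fixes h :: "real \<Rightarrow> real"
  assumes "h integrable_on {a..b}" "negligible N" "\<And>t. t \<in> {a..b} - N \<Longrightarrow> h (a + b - t) = - h t"
  shows "(h has_integral 0) {a..b}"
proof -
  obtain i where i: "(h has_integral i) {a..b}" using assms(1) by blast
  have "((\<lambda>t. - h t) has_integral i) {a..b}"
    by (rule has_integral_spike[OF assms(2) _ has_integral_reflect_interval[OF i]]) (use assms(3) in auto)
  moreover have "((\<lambda>t. - h t) has_integral - i) {a..b}"
    by (rule has_integral_neg[OF i])
  ultimately have "i = - i" by (rule has_integral_unique)
  with i show ?thesis by simp
qed

text \<open>The integrand is odd under \<open>t \<mapsto> pi - t\<close>, but this map does not
  preserve \<open>{0..2 * pi}\<close>. Hence the split at \<open>pi\<close>: on the upper half the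
  reflection is \<open>t \<mapsto> 3 * pi - t\<close>, which acts in the same way by periodicity. As
  the symmetry of \<open>f\<close> holds only almost everywhere, a negligible set is carried
  along.\<close>

lemma sine_integral_0:
  assumes f: "f \<in> L2_circle R" and sym: "refl_sym R f"
  shows "(LINT t|circ. f (rcis R t) * sin (of_int k * (t - pi / 2))) = 0"
proof -
  define h where "h t = f (rcis R t) * sin (of_int k * (t - pi / 2))" for t
  have "continuous_on UNIV (\<lambda>t. sin (of_int k * (t - pi / 2)))" by (intro continuous_intros)
  from L2_integrable_mult[OF f this] have int: "integrable circ h"
    unfolding h_def by simp
  have hint: "(h has_integral (LINT t|circ. h t)) {0..2 * pi}"
    by (rule has_integral_integral_lebesgue_on[OF int]) simp
  have sub: "h integrable_on {0..pi}" "h integrable_on {pi..2 * pi}"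
    by (rule integrable_subinterval_real[OF has_integral_integrable[OF hint]]; simp)+
  have "AE t in lebesgue. t \<in> {0..2 * pi} \<longrightarrow> f (- cnj (rcis R t)) = f (rcis R t)"
    using sym by (simp add: refl_sym_def AE_restrict_space_iff)
  then obtain N where N0: "N \<in> null_sets lebesgue"
      "{t \<in> space lebesgue. \<not> (t \<in> {0..2 * pi} \<longrightarrow> f (- cnj (rcis R t)) = f (rcis R t))} \<subseteq> N"
    unfolding eventually_ae_filter by (elim bexE)
  then have N1: "negligible N" by (simp add: negligible_iff_null_sets)
  have N2: "f (rcis R (pi - t)) = f (rcis R t)" if "t \<in> {0..2 * pi} - N" for t
    using that subsetD[OF N0(2), of t] by (auto simp: minus_cnj_rcis)
  have sin1: "sin (of_int k * (pi - t - pi / 2)) = - sin (of_int k * (t - pi / 2))" for t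
  proof -
    have "of_int k * (pi - t - pi / 2) = - (of_int k * (t - pi / 2))"
      by (simp add: algebra_simps)
    then show ?thesis by (simp only: sin_minus)
  qed
  have sin2: "sin (of_int k * (3 * pi - t - pi / 2)) = sin (of_int k * (pi - t - pi / 2))" for t
  proof -
    have "of_int k * (3 * pi - t - pi / 2) = of_int k * (pi - t - pi / 2) + 2 * pi * of_int k"
      by (simp add: algebra_simps)
    then show ?thesis by (simp only: sin_add sin_int_2pin cos_int_2pin)
  qed
  have rcis2: "rcis R (3 * pi - t) = rcis R (pi - t)" for t
  proof -
    have "3 * pi - t = (pi - t) + 2 * pi" by simp
    then show ?thesis by (simp only: rcis_def cis_mult[symmetric] cis_2pi) simp
  qed
  have "(h has_integral 0) {0..pi}"
  proof (rule has_integral_antisymmetric[OF sub(1) N1])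
    fix t assume t: "t \<in> {0..pi} - N"
    have "h (pi - t) = - h t"
      unfolding h_def sin1 using N2[of t] t by auto
    then show "h (0 + pi - t) = - h t" by simp
  qed
  moreover have "(h has_integral 0) {pi..2 * pi}"
  proof (rule has_integral_antisymmetric[OF sub(2) N1])
    fix t assume t: "t \<in> {pi..2 * pi} - N"
    then have "0 \<le> t" using pi_ge_zero unfolding atLeastAtMost_iff Diff_iff by linarith
    then have "h (3 * pi - t) = - h t"
      unfolding h_def rcis2 sin2 sin1 using N2[of t] t by auto
    then show "h (pi + 2 * pi - t) = - h t" by simp
  qed
  ultimately have "(h has_integral 0 + 0) {0..2 * pi}"
    by (intro has_integral_combine[of 0 pi "2 * pi"]) auto
  from has_integral_unique[OF hint this] show ?thesis
    by (simp add: h_def)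
qed

text \<open>Shifting the angle by \<open>pi / 2\<close> costs only a phase, which the modulus
  removes, and the sine part vanishes by symmetry. A cosine of frequency \<open>n > 0\<close> is
  shared between the frequencies \<open>n\<close> and \<open>-n\<close>, whence the 2.\<close>

lemma cmod_fourier_coeff:
  assumes f: "f \<in> L2_circle R" and sym: "refl_sym R f"
  shows "cmod (fourier_coeff R f k)
    = \<bar>cosine_coeff R f (nat \<bar>k\<bar>)\<bar> / (if k = 0 then 1 else 2)"
proof -
  let ?c = "\<lambda>t. f (rcis R t) * cos (of_int k * (t - pi / 2))"
  let ?s = "\<lambda>t. f (rcis R t) * sin (of_int k * (t - pi / 2))"
  have cont: "continuous_on UNIV (\<lambda>t. cos (of_int k * (t - pi / 2)))"
    "continuous_on UNIV (\<lambda>t. sin (of_int k * (t - pi / 2)))" by (intro continuous_intros)+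
  have int: "integrable circ ?c" "integrable circ ?s"
    by (auto intro!: L2_integrable_mult[OF f] cont)
  have "complex_of_real (f (rcis R t)) * cis (- of_int k * t)
      = cis (- of_int k * (pi / 2)) * (of_real (?c t) - \<i> * of_real (?s t))" for t
  proof -
    have "cis (- of_int k * t) = cis (- of_int k * (pi / 2)) * cis (- (of_int k * (t - pi / 2)))"
      by (simp add: cis_mult algebra_simps)
    also have "cis (- (of_int k * (t - pi / 2)))
        = of_real (cos (of_int k * (t - pi / 2))) - \<i> * of_real (sin (of_int k * (t - pi / 2)))"
      by (simp add: complex_eq_iff)
    finally show ?thesis by (simp only: of_real_mult) (simp only: algebra_simps)
  qed
  then have "(LINT t|circ. complex_of_real (f (rcis R t)) * cis (- of_int k * t))
      = (LINT t|circ. cis (- of_int k * (pi / 2)) * (of_real (?c t) - \<i> * of_real (?s t)))"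
    by (simp only:)
  also have "\<dots> = cis (- of_int k * (pi / 2)) * (LINT t|circ. (of_real (?c t) - \<i> * of_real (?s t)))"
    by (rule Bochner_Integration.integral_mult_right_zero)
  also have "(LINT t|circ. (of_real (?c t) - \<i> * of_real (?s t)))
      = (LINT t|circ. complex_of_real (?c t)) - (LINT t|circ. \<i> * of_real (?s t))"
    using int by (intro Bochner_Integration.integral_diff integrable_mult_right
        integrable_of_real) auto
  also have "(LINT t|circ. \<i> * complex_of_real (?s t)) = 0"
    using sine_integral_0[OF f sym, of k]
    by (simp only: Bochner_Integration.integral_mult_right_zero integral_complex_of_real) simp
  finally have "cmod (LINT t|circ. complex_of_real (f (rcis R t)) * cis (- of_int k * t))
      = \<bar>LINT t|circ. ?c t\<bar>"
    by (simp only: integral_complex_of_real norm_mult norm_cis diff_0_right norm_of_real mult_1)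
  moreover have "cos (of_int k * x) = cos (real (nat \<bar>k\<bar>) * x)" for x
    by (cases "k \<ge> 0") auto
  ultimately show ?thesis
    by (simp add: fourier_coeff_def cosine_coeff_def abs_mult)
qed

section \<open>Sobolev norms and cosine series\<close>

lemma range_int_eq: "range int = {0..}"
  by (auto simp: image_iff intro: nonneg_int_cases)

text \<open>Comparability up to a factor 2 is enough later. It lets the negative half be estimated
  by \<open>{..0}\<close>, the mirror image of \<open>{0..}\<close>, although this counts index 0
  twice.\<close>

lemma
  fixes A :: "int \<Rightarrow> real"
  assumes nonneg: "\<And>n. 0 \<le> A n" and even: "\<And>n. A (- n) = A n"
  shows even_summable_int_iff: "A summable_on UNIV \<longleftrightarrow> summable (\<lambda>n. A (int n))"
    and even_infsum_int_ge: "A summable_on UNIV \<Longrightarrow> (\<Sum>n. A (int n)) \<le> infsum A UNIV"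
    and even_infsum_int_le: "A summable_on UNIV \<Longrightarrow> infsum A UNIV \<le> 2 * (\<Sum>n. A (int n))"
proof -
  have nat_iff: "A summable_on {0..} \<longleftrightarrow> (\<lambda>n. A (int n)) summable_on UNIV"
    using summable_on_reindex[of int UNIV A] by (simp add: range_int_eq o_def)
  have nat_eq: "infsum A {0..} = infsum (\<lambda>n. A (int n)) UNIV"
    using infsum_reindex[of int UNIV A] by (simp add: range_int_eq o_def)
  have neg_iff: "A summable_on {..0} \<longleftrightarrow> A summable_on {0..}"
    using summable_on_reindex[of uminus "{0::int..}" A] even by (simp add: o_def)
  have neg_eq: "infsum A {..0} = infsum A {0..}"
    using infsum_reindex[of uminus "{0::int..}" A] even by (simp add: o_def)
  have nat_sums: "infsum (\<lambda>n. A (int n)) UNIV = (\<Sum>n. A (int n))" if "(\<lambda>n. A (int n)) summable_on UNIV"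
    using has_sum_imp_sums[OF has_sum_infsum[OF that]] sums_unique by metis
  have split: "(UNIV :: int set) = {0..} \<union> {..<0}" by auto
  show iff: "A summable_on UNIV \<longleftrightarrow> summable (\<lambda>n. A (int n))"
  proof
    assume "A summable_on UNIV"
    then have "A summable_on {0..}" by (rule summable_on_subset_banach) simp
    then show "summable (\<lambda>n. A (int n))"
      unfolding nat_iff by (rule summable_on_imp_summable)
  next
    assume "summable (\<lambda>n. A (int n))"
    then have 1: "A summable_on {0..}"
      unfolding nat_iff using nonneg by (intro norm_summable_imp_summable_on) simp
    then have "A summable_on {..0}" by (simp add: neg_iff)
    then have "A summable_on {..<0}" by (rule summable_on_subset_banach) auto
    with 1 show "A summable_on UNIV"
      unfolding split by (intro summable_on_Un_disjoint) auto
  qed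
  assume A: "A summable_on UNIV"
  have s: "A summable_on S" for S
    using A by (rule summable_on_subset_banach) simp
  have "(\<Sum>n. A (int n)) = infsum A {0..}"
    using nat_sums nat_iff s nat_eq by simp
  moreover have "infsum A {0..} \<le> infsum A UNIV"
    using nonneg by (intro infsum_mono_neutral s) auto
  moreover have "infsum A UNIV = infsum A {0..} + infsum A {..<0}"
    unfolding split by (intro infsum_Un_disjoint s) auto
  moreover have "infsum A {..<0} \<le> infsum A {..0}"
    using nonneg by (intro infsum_mono_neutral s) auto
  ultimately show "(\<Sum>n. A (int n)) \<le> infsum A UNIV" "infsum A UNIV \<le> 2 * (\<Sum>n. A (int n))"
    using neg_eq by auto
qed

lemma sobolev_weight_bounds:
  assumes "1 \<le> R" "0 \<le> s"
  shows "(1 + (real n / R)\<^sup>2) powr s \<le> (1 + real n) powr (2 * s)"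
    and "(1 + real n) powr (2 * s) \<le> (2 * R\<^sup>2) powr s * (1 + (real n / R)\<^sup>2) powr s"
proof -
  have e: "(1 + real n) powr (2 * s) = ((1 + real n)\<^sup>2) powr s"
  proof -
    have "(1 + real n) powr (2 * s) = ((1 + real n) powr 2) powr s"
      by (simp only: powr_powr)
    also have "(1 + real n) powr 2 = (1 + real n)\<^sup>2"
      by (rule powr_numeral) simp
    finally show ?thesis .
  qed
  have "(real n / R)\<^sup>2 \<le> (real n)\<^sup>2"
    using assms by (intro power_mono) (auto simp: divide_le_eq mult_le_cancel_left1)
  then have "1 + (real n / R)\<^sup>2 \<le> (1 + real n)\<^sup>2"
    by (simp add: power2_eq_square algebra_simps)
  then show "(1 + (real n / R)\<^sup>2) powr s \<le> (1 + real n) powr (2 * s)"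
    unfolding e using assms by (intro powr_mono2) auto
  have "(1 + real n)\<^sup>2 \<le> 2 * (1 + (real n)\<^sup>2)"
    using square_add_le[of 1 "real n"] by simp
  also have "\<dots> \<le> 2 * (R\<^sup>2 + (real n)\<^sup>2)"
    using assms by simp
  also have "\<dots> = (2 * R\<^sup>2) * (1 + (real n / R)\<^sup>2)"
    using assms by (simp add: power_divide field_simps)
  finally have "((1 + real n)\<^sup>2) powr s \<le> ((2 * R\<^sup>2) * (1 + (real n / R)\<^sup>2)) powr s"
    using assms by (intro powr_mono2) auto
  also have "\<dots> = (2 * R\<^sup>2) powr s * (1 + (real n / R)\<^sup>2) powr s"
    by (rule powr_mult)
  finally show "(1 + real n) powr (2 * s) \<le> (2 * R\<^sup>2) powr s * (1 + (real n / R)\<^sup>2) powr s"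
    unfolding e .
qed

text \<open>Transfer to sequences: apart from nonnegativity, the two comparisons are all that is
  used of the Sobolev norm from here on.\<close>

lemma
  assumes f: "f \<in> L2_circle R" and sym: "refl_sym R f" and R: "1 \<le> R" and s: "0 \<le> s"
  shows sobolev_sym_iff: "f \<in> sobolev_sym s R \<longleftrightarrow> hs_mem s (cosine_coeff R f)"
    and sobolev_norm_le: "hs_mem s (cosine_coeff R f) \<Longrightarrow>
      (sobolev_norm s R f)\<^sup>2 \<le> 4 * pi * R * hs_sq s (cosine_coeff R f)"
    and sobolev_norm_ge: "hs_mem s (cosine_coeff R f) \<Longrightarrow>
      hs_sq s (cosine_coeff R f) \<le> 4 * (2 * R\<^sup>2) powr s * (sobolev_norm s R f)\<^sup>2"
proof -
  define A where "A n = (1 + (of_int n / R)\<^sup>2) powr s * (cmod (fourier_coeff R f n))\<^sup>2" for n :: int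
  define B where "B n = (cosine_coeff R f n)\<^sup>2 * (1 + real n) powr (2 * s)" for n
  \<comment> \<open>The 4 undoes the halving of the cosine coefficients at nonzero frequencies; the
    other factor compares the two weights.\<close>
  define K where "K = 4 * (2 * R\<^sup>2) powr s"
  have nonneg: "0 \<le> A n" for n by (simp add: A_def)
  have even: "A (- n) = A n" for n
    by (simp add: A_def cmod_fourier_coeff[OF f sym])
  have A_nat: "A (int n) = (1 + (real n / R)\<^sup>2) powr s
      * ((cosine_coeff R f n)\<^sup>2 / (if n = 0 then 1 else 4))" for n
    by (simp add: A_def cmod_fourier_coeff[OF f sym] power_divide)
  have le: "A (int n) \<le> B n" for n
  proof -
    have "(cosine_coeff R f n)\<^sup>2 / (if n = 0 then 1 else 4) \<le> (cosine_coeff R f n)\<^sup>2"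
      by simp
    then show ?thesis
      unfolding A_nat B_def using mult_mono[OF sobolev_weight_bounds(1)[OF R s, of n], of
          "(cosine_coeff R f n)\<^sup>2 / (if n = 0 then 1 else 4)" "(cosine_coeff R f n)\<^sup>2"]
      by (simp add: mult.commute)
  qed
  have ge: "B n \<le> K * A (int n)" for n
  proof -
    have "(cosine_coeff R f n)\<^sup>2 \<le> 4 * ((cosine_coeff R f n)\<^sup>2 / (if n = 0 then 1 else 4))"
      by simp
    from mult_mono[OF this sobolev_weight_bounds(2)[OF R s, of n]] show ?thesis
      unfolding A_nat B_def K_def by (simp add: mult_ac)
  qed
  have norm_eq: "(sobolev_norm s R f)\<^sup>2 = 2 * pi * R * infsum A UNIV"
    unfolding sobolev_norm_def A_def[symmetric] using R
    by (simp add: infsum_nonneg nonneg)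
  have sum_iff: "summable (\<lambda>n. A (int n)) \<longleftrightarrow> summable B"
  proof
    assume "summable (\<lambda>n. A (int n))"
    from summable_mult[OF this, of K] show "summable B"
      by (rule summable_comparison_test') (use ge in \<open>auto simp: B_def\<close>)
  next
    assume "summable B"
    then show "summable (\<lambda>n. A (int n))"
      by (rule summable_comparison_test') (use le nonneg in auto)
  qed
  have mem_B: "hs_mem s (cosine_coeff R f) \<longleftrightarrow> summable B"
    by (simp add: hs_mem_def B_def[abs_def])
  have mem_iff: "hs_mem s (cosine_coeff R f) \<longleftrightarrow> A summable_on UNIV"
    using even_summable_int_iff[of A] nonneg even sum_iff mem_B by simp
  show "f \<in> sobolev_sym s R \<longleftrightarrow> hs_mem s (cosine_coeff R f)"
    unfolding mem_iff using f sym
    by (simp add: sobolev_sym_def sobolev_circle_def A_def[abs_def] refl_sym_def)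
  assume "hs_mem s (cosine_coeff R f)"
  then have A: "A summable_on UNIV" "summable (\<lambda>n. A (int n))" "summable B"
    using mem_iff sum_iff mem_B by auto
  have sq: "hs_sq s (cosine_coeff R f) = suminf B"
    by (simp add: hs_sq_def B_def[abs_def])
  have "infsum A UNIV \<le> 2 * (\<Sum>n. A (int n))"
    by (rule even_infsum_int_le[OF nonneg even A(1)])
  also have "(\<Sum>n. A (int n)) \<le> suminf B"
    by (rule suminf_le[OF le A(2,3)])
  finally have "2 * pi * R * infsum A UNIV \<le> 2 * pi * R * (2 * suminf B)"
    using R by (intro mult_left_mono) auto
  then show "(sobolev_norm s R f)\<^sup>2 \<le> 4 * pi * R * hs_sq s (cosine_coeff R f)"
    by (simp add: norm_eq sq)
  have "suminf B \<le> (\<Sum>n. K * A (int n))"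
    by (rule suminf_le[OF ge A(3) summable_mult[OF A(2)]])
  also have "\<dots> = K * (\<Sum>n. A (int n))"
    by (rule suminf_mult[OF A(2)])
  also have "\<dots> \<le> K * infsum A UNIV"
    by (intro mult_left_mono even_infsum_int_ge nonneg even A(1)) (simp add: K_def)
  \<comment> \<open>The arc length factor in the squared norm is at least 1 and can be
    inserted.\<close>
  also have "\<dots> \<le> K * (2 * pi * R * infsum A UNIV)"
  proof -
    have "1 * 1 \<le> (2 * pi) * R" using R pi_gt3 by (intro mult_mono) auto
    then have "1 * infsum A UNIV \<le> (2 * pi * R) * infsum A UNIV"
      by (intro mult_right_mono) (auto simp: infsum_nonneg nonneg)
    then show ?thesis by (intro mult_left_mono) (auto simp: K_def)
  qed
  finally show "hs_sq s (cosine_coeff R f) \<le> 4 * (2 * R\<^sup>2) powr s * (sobolev_norm s R f)\<^sup>2"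
    by (simp add: norm_eq sq K_def)
qed

lemma sobolev_symD:
  assumes "f \<in> sobolev_sym s R"
  shows "f \<in> L2_circle R" "refl_sym R f"
  using assms by (auto simp: sobolev_sym_def sobolev_circle_def refl_sym_def)

section \<open>Orthogonality of cosines and absolutely convergent cosine series\<close>

lemma integral_cos_int:
  assumes "k \<noteq> 0"
  shows "(LINT t|circ. cos (of_int k * (t - pi / 2))) = 0"
proof -
  have "((\<lambda>t. cos (of_int k * (t - pi / 2))) has_integral
      sin (of_int k * (2 * pi - pi / 2)) / of_int k - sin (of_int k * (0 - pi / 2)) / of_int k) {0..2 * pi}"
    using assms by (intro fundamental_theorem_of_calculus)
      (auto intro!: derivative_eq_intros simp flip: has_real_derivative_iff_has_vector_derivative)
  moreover have "sin (of_int k * (2 * pi - pi / 2)) = sin (of_int k * (0 - pi / 2))"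
  proof -
    have "of_int k * (2 * pi - pi / 2) = of_int k * (0 - pi / 2) + 2 * pi * of_int k"
      by (simp add: algebra_simps)
    then show ?thesis by (simp only: sin_add sin_int_2pin cos_int_2pin)
  qed
  ultimately have 0: "((\<lambda>t. cos (of_int k * (t - pi / 2))) has_integral 0) {0..2 * pi}"
    by simp
  have "integrable circ (\<lambda>t. cos (of_int k * (t - pi / 2)))"
    by (rule integrable_circ_bounded[OF continuous_measurable_circ, of _ 1])
      (auto intro!: continuous_intros)
  from has_integral_integral_lebesgue_on[OF this] show ?thesis
    using has_integral_unique[OF _ 0] by simp
qed

lemma integral_cos_mult_cos:
  "(LINT t|circ. cos (real n * (t - pi / 2)) * cos (real m * (t - pi / 2)))
    = (if n = m then (if m = 0 then 2 * pi else pi) else 0)"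
proof -
  have eq: "cos (real n * x) * cos (real m * x)
      = (1/2) * cos (of_int (int n - int m) * x) + (1/2) * cos (of_int (int n + int m) * x)" for x
    by (simp add: cos_times_cos left_diff_distrib distrib_right add_divide_distrib)
  have int: "integrable circ (\<lambda>t. cos (of_int k * (t - pi / 2)))" for k
    by (rule integrable_circ_bounded[OF continuous_measurable_circ, of _ 1])
      (auto intro!: continuous_intros)
  have "(LINT t|circ. cos (real n * (t - pi / 2)) * cos (real m * (t - pi / 2)))
      = (LINT t|circ. (1/2) * cos (of_int (int n - int m) * (t - pi / 2)))
      + (LINT t|circ. (1/2) * cos (of_int (int n + int m) * (t - pi / 2)))"
    unfolding eq by (intro Bochner_Integration.integral_add integrable_mult_right int)
  also have "\<dots> = (1/2) * (LINT t|circ. cos (of_int (int n - int m) * (t - pi / 2)))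
      + (1/2) * (LINT t|circ. cos (of_int (int n + int m) * (t - pi / 2)))"
    by (simp only: Bochner_Integration.integral_mult_right_zero)
  finally have *: "(LINT t|circ. cos (real n * (t - pi / 2)) * cos (real m * (t - pi / 2)))
      = (1/2) * (LINT t|circ. cos (of_int (int n - int m) * (t - pi / 2)))
      + (1/2) * (LINT t|circ. cos (of_int (int n + int m) * (t - pi / 2)))" .
  have val: "(LINT t|circ. cos (of_int k * (t - pi / 2))) = (if k = 0 then 2 * pi else 0)" for k
    using integral_cos_int[of k] by (simp add: measure_restrict_space)
  show ?thesis unfolding * val by auto
qed

text \<open>Absolute summability of \<open>c\<close> bounds the sum, which gives \<open>L^2\<close>
  on a finite measure space, and justifies the termwise integration that reads off the coefficients
  by orthogonality.\<close>

lemma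
  assumes f: "\<And>t. (\<lambda>n. c n * cos (real n * (t - pi / 2))) sums f (rcis R t)"
    and c: "summable (\<lambda>n. \<bar>c n\<bar>)"
  shows cosine_series_L2: "f \<in> L2_circle R"
    and cosine_series_sym: "refl_sym R f"
    and cosine_series_coeff: "cosine_coeff R f = c"
proof -
  have f_eq: "f (rcis R t) = (\<Sum>n. c n * cos (real n * (t - pi / 2)))" for t
    using f by (rule sums_unique)
  have meas[measurable]: "(\<lambda>t. c n * cos (real n * (t - pi / 2))) \<in> borel_measurable circ" for n
    by (intro continuous_measurable_circ continuous_intros)
  have le: "\<bar>c n * cos x\<bar> \<le> \<bar>c n\<bar>" for n x
    using mult_left_mono[OF abs_cos_le_one[of x], of "\<bar>c n\<bar>"] by (simp add: abs_mult)
  have bd: "\<bar>f (rcis R t)\<bar> \<le> (\<Sum>n. \<bar>c n\<bar>)" for t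
    unfolding f_eq using norm_suminf_le[of "\<lambda>n. c n * cos (real n * (t - pi / 2))", OF _ c] le by simp
  have f_meas[measurable]: "(\<lambda>t. f (rcis R t)) \<in> borel_measurable circ"
    unfolding f_eq by measurable
  have "integrable circ (\<lambda>t. (f (rcis R t))\<^sup>2)"
  proof (rule integrable_circ_bounded)
    show "\<bar>(f (rcis R t))\<^sup>2\<bar> \<le> (\<Sum>n. \<bar>c n\<bar>)\<^sup>2" for t
      using power_mono[OF bd[of t] abs_ge_zero, of 2] by simp
  qed measurable
  then show L2: "f \<in> L2_circle R" by (simp add: L2_circle_def)
  have "f (rcis R (pi - t)) = f (rcis R t)" for t
  proof -
    have "real n * (pi - t - pi / 2) = - (real n * (t - pi / 2))" for n
      by (simp add: algebra_simps)
    then show ?thesis unfolding f_eq by (simp only: cos_minus)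
  qed
  then show "refl_sym R f" by (simp add: refl_sym_def minus_cnj_rcis)
  show "cosine_coeff R f = c"
  proof
    fix m
    let ?g = "\<lambda>n t. c n * cos (real n * (t - pi / 2)) * cos (real m * (t - pi / 2))"
    have g_le: "\<bar>?g n t\<bar> \<le> \<bar>c n\<bar>" for n t
      using mult_mono[OF le[of n "real n * (t - pi / 2)"] abs_cos_le_one[of "real m * (t - pi / 2)"]]
      by (simp add: abs_mult)
    have g_meas: "?g n \<in> borel_measurable circ" for n
      by (intro continuous_measurable_circ continuous_intros)
    have g_int: "integrable circ (?g n)" for n
      by (rule integrable_circ_bounded[OF g_meas g_le])
    have "(\<lambda>n. LINT t|circ. ?g n t) sums (LINT t|circ. (\<Sum>n. ?g n t))"
    proof (rule sums_integral[OF g_int])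
      show "AE t in circ. summable (\<lambda>n. norm (?g n t))"
        using g_le by (intro AE_I2 summable_comparison_test'[OF c]) auto
      have "(LINT t|circ. norm (?g n t)) \<le> \<bar>c n\<bar> * (2 * pi)" for n
      proof -
        have "(LINT t|circ. norm (?g n t)) \<le> (LINT t|circ. \<bar>c n\<bar>)"
          using g_le g_int finite_measure.integrable_const[OF finite_circ]
          by (intro integral_mono) auto
        then show ?thesis by (simp add: measure_restrict_space mult.commute)
      qed
      then show "summable (\<lambda>n. LINT t|circ. norm (?g n t))"
        by (intro summable_comparison_test'[OF summable_mult2[OF c, of "2 * pi"]]) auto
    qed
    moreover have "(\<Sum>n. ?g n t) = f (rcis R t) * cos (real m * (t - pi / 2))" for t
      unfolding f_eq by (intro suminf_mult2[symmetric] sums_summable[OF f])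
    moreover have "(LINT t|circ. ?g n t) = (if n = m then c m * (if m = 0 then 2 * pi else pi) else 0)" for n
      using integral_cos_mult_cos[of n m] by (simp add: mult.assoc)
    ultimately have "(\<lambda>n. if n = m then c m * (if m = 0 then 2 * pi else pi) else 0) sums
        (LINT t|circ. f (rcis R t) * cos (real m * (t - pi / 2)))"
      by simp
    from sums_unique2[OF this sums_single]
    have "(LINT t|circ. f (rcis R t) * cos (real m * (t - pi / 2))) = c m * (if m = 0 then 2 * pi else pi)"
      by simp
    then show "cosine_coeff R f m = c m" by (simp add: cosine_coeff_def)
  qed
qed

section \<open>The expansion operator\<close>

text \<open>The column \<open>j = 0\<close> of the expansion matrix is \<open>1 / a0\<close> times the first unit vector; dividing
  row \<open>0\<close> by \<open>1 / a0\<close> turns the expansion matrix into \<open>I + corr_mat\<close>.\<close>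

definition corr_mat :: "real \<Rightarrow> real \<Rightarrow> nat \<Rightarrow> nat \<Rightarrow> real" where
  "corr_mat a0 R n j = (if j = 0 then 0 else (if n = 0 then a0 else 1) * corr (alpha a0) R n j)"

definition row_scale :: "real \<Rightarrow> nat \<Rightarrow> real" where
  "row_scale a0 n = (if n = 0 then 1 / a0 else 1)"

lemma expansion_matrix_eq:
  assumes "a0 > 0"
  shows "(if n = j then 1 else 0) + corr (alpha a0) R n j
    = row_scale a0 n * ((if n = j then 1 else 0) + corr_mat a0 R n j)"
proof (cases "n = 0 \<and> j = 0")
  case True
  have "1 - alpha a0 = 2 / (a0 + 1)" "1 + alpha a0 = 2 * a0 / (a0 + 1)"
    using assms by (auto simp: alpha_def field_simps)
  then have "1 - alpha a0 = 1 / a0 * (1 + alpha a0)" "1 + alpha a0 \<noteq> 0"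
    using assms by auto
  then have "(1 - alpha a0) / (1 + alpha a0) = 1 / a0"
    by (metis nonzero_mult_div_cancel_right)
  with True show ?thesis
    using corr_0_0[OF abs_alpha_less_1[OF assms], of R] by (simp add: corr_mat_def row_scale_def)
next
  case False
  then show ?thesis
    using assms corr_0_right[of n] by (auto simp: corr_mat_def row_scale_def field_simps)
qed

lemma times_geometric_bounded:
  fixes q :: real
  assumes "0 < q" "q < 1"
  obtains K where "0 \<le> K" "\<And>n. real n * q ^ n \<le> K"
proof -
  have "(\<lambda>n. real n * q ^ n) \<longlonglongrightarrow> 0"
    using powser_times_n_limit_0[of q] assms by simp
  then have "Bseq (\<lambda>n. real n * q ^ n)"
    by (intro convergent_imp_Bseq convergentI)
  then obtain K where "\<forall>n. norm (real n * q ^ n) \<le> K"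
    by (elim BseqE)
  then show thesis using assms by (intro that[of "\<bar>K\<bar>"]) (auto simp: abs_mult intro: order_trans)
qed

text \<open>Rows \<open>n > 0\<close> contract by \<open>corr_row_sum\<close>. Row 0 has no such
  estimate; its sum is merely finite, by the decay of \<open>corr\<close>. Since column 0 of
  \<open>corr_mat\<close> is zero, enlarging \<open>w 0 = L\<close> changes no row sum but relaxes
  the requirement on row 0.\<close>

lemma corr_mat_contraction:
  assumes "a0 > 0" "R > 2"
  obtains w A B q \<theta> where "contraction_matrix (corr_mat a0 R) w A B q \<theta>"
proof -
  define q where "q = 2 / R"
  define A where "A = 2 * (\<bar>alpha a0\<bar> / (1 - \<bar>alpha a0\<bar>))"
  \<comment> \<open>Below 1, at least \<open>\<bar>alpha a0\<bar>\<close> for the rows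
    \<open>n > 0\<close>, and at least \<open>1 / 2\<close> for row 0, whose sum is at most
    \<open>L / 2\<close> by the choice of \<open>L\<close>.\<close>
  define \<theta> where "\<theta> = (1 + \<bar>alpha a0\<bar>) / 2"
  define L where "L = 1 + 2 * (a0 * A / (1 - q))"
  define w where "w n = (if n = 0 then L else 1 / real n)" for n
  have q: "0 < q" "q < 1" using assms by (auto simp: q_def)
  obtain K where K: "0 \<le> K" "\<And>n. real n * q ^ n \<le> K"
    using times_geometric_bounded[OF q] by blast
  note \<alpha> = abs_alpha_less_1[OF assms(1)]
  have A: "0 \<le> A" using \<alpha> by (simp add: A_def)
  have L: "1 \<le> L" using A q assms by (simp add: L_def)
  have corr_le: "\<bar>corr (alpha a0) R n j\<bar> \<le> A * q ^ (n + j)" for n j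
    unfolding A_def q_def using abs_corr_le[OF \<alpha>] assms by simp
  have row: "(\<Sum>j<J. \<bar>corr_mat a0 R n j\<bar> * w j)
      \<le> (if n = 0 then a0 else 1) * (\<Sum>j=1..J. \<bar>corr (alpha a0) R n j\<bar> / real j)" for n J
  proof -
    let ?g = "\<lambda>j. \<bar>corr_mat a0 R n j\<bar> * w j"
    have "(\<Sum>j<J. ?g j) \<le> (\<Sum>j\<in>insert 0 {1..J}. ?g j)"
      using L by (intro sum_mono2) (auto simp: w_def)
    also have "\<dots> = (\<Sum>j=1..J. ?g j)" by (simp add: corr_mat_def)
    also have "\<dots> = (\<Sum>j=1..J. (if n = 0 then a0 else 1) * (\<bar>corr (alpha a0) R n j\<bar> / real j))"
      using assms by (intro sum.cong) (auto simp: corr_mat_def w_def abs_mult)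
    also have "\<dots> = (if n = 0 then a0 else 1) * (\<Sum>j=1..J. \<bar>corr (alpha a0) R n j\<bar> / real j)"
      by (rule sum_distrib_left[symmetric])
    finally show ?thesis .
  qed
  \<comment> \<open>The factor \<open>1 + a0\<close> absorbs the scaling of row 0. In
    \<open>L + 1 + K\<close>, the parts \<open>L\<close> and \<open>1\<close> bound
    \<open>w\<close>, and \<open>K\<close> bounds \<open>n * q ^ n\<close>, which is what
    \<open>pow_le_w\<close> asks for when \<open>w n = 1 / n\<close>.\<close>
  have "contraction_matrix (corr_mat a0 R) w ((1 + a0) * A) (L + 1 + K) q \<theta>"
  proof
    show "\<bar>corr_mat a0 R n j\<bar> \<le> (1 + a0) * A * q ^ (n + j)" for n j
    proof -
      have "\<bar>corr_mat a0 R n j\<bar> \<le> (1 + a0) * \<bar>corr (alpha a0) R n j\<bar>"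
        using assms by (auto simp: corr_mat_def abs_mult distrib_right)
      also have "\<dots> \<le> (1 + a0) * (A * q ^ (n + j))"
        using assms by (intro mult_left_mono corr_le) auto
      finally show ?thesis by simp
    qed
    show "0 < q" "q < 1" by fact+
    show "0 < w n" for n using L by (simp add: w_def)
    show "w n \<le> L + 1 + K" for n
    proof (cases "n = 0")
      case False
      then have "1 / real n \<le> 1" by simp
      then have "1 / real n \<le> L + 1 + K" using L K(1) by linarith
      then show ?thesis using False by (simp only: w_def if_False)
    qed (use K(1) in \<open>simp add: w_def\<close>)
    show "q ^ n \<le> (L + 1 + K) * w n" for n
    proof (cases "n = 0")
      case True
      have "1 * 1 \<le> (L + 1 + K) * L" using L K(1) by (intro mult_mono) auto
      then show ?thesis using True by (simp add: w_def)
    next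
      case False
      have "real n * q ^ n \<le> L + 1 + K" using K(2)[of n] L by linarith
      then show ?thesis using False by (simp add: w_def field_simps)
    qed
    show "0 \<le> \<theta>" "\<theta> < 1" using \<alpha> by (auto simp: \<theta>_def)
    show "(\<Sum>j<J. \<bar>corr_mat a0 R n j\<bar> * w j) \<le> \<theta> * w n" for J n
    proof (cases "n = 0")
      case True
      have le: "\<bar>corr (alpha a0) R 0 j\<bar> / real j \<le> A * q ^ j" for j
      proof (cases "j = 0")
        case False
        then have "\<bar>corr (alpha a0) R 0 j\<bar> / real j \<le> \<bar>corr (alpha a0) R 0 j\<bar> / 1"
          by (intro divide_left_mono) auto
        then show ?thesis using corr_le[of 0 j] by simp
      qed (use A in simp)
      have geo: "(\<lambda>j. A * q ^ j) sums (A * (1 / (1 - q)))"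
        using q by (intro sums_mult geometric_sums) auto
      have "(\<Sum>j=1..J. \<bar>corr (alpha a0) R 0 j\<bar> / real j) \<le> (\<Sum>j=1..J. A * q ^ j)"
        by (intro sum_mono le)
      also have "\<dots> \<le> A / (1 - q)"
        using sum_le_suminf[OF sums_summable[OF geo], of "{1..J}"] A q sums_unique[OF geo] by simp
      finally have "a0 * (\<Sum>j=1..J. \<bar>corr (alpha a0) R 0 j\<bar> / real j) \<le> a0 * (A / (1 - q))"
        using assms by (intro mult_left_mono) auto
      also have "\<dots> \<le> 1 / 2 * L" by (simp add: L_def mult_ac)
      also have "\<dots> \<le> \<theta> * L" using L by (intro mult_right_mono) (auto simp: \<theta>_def)
      finally show ?thesis using row[of n J] True by (simp add: w_def)
    next
      case False
      then have "(\<Sum>j<J. \<bar>corr_mat a0 R n j\<bar> * w j) \<le> \<bar>alpha a0\<bar> / real n"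
        using row[of n J] corr_row_sum[OF \<alpha>, of R n J] assms by simp
      also have "\<dots> \<le> \<theta> / real n"
        using \<alpha> by (intro divide_right_mono) (auto simp: \<theta>_def)
      finally show ?thesis using False by (simp add: w_def)
    qed
  qed
  then show thesis by (rule that)
qed

text \<open>Formally the cosine coefficients of \<open>\<Sum>j. b j * u_j\<close>.\<close>

definition expansion_op :: "real \<Rightarrow> real \<Rightarrow> (nat \<Rightarrow> real) \<Rightarrow> nat \<Rightarrow> real" where
  "expansion_op a0 R b n = row_scale a0 n * (b n + mat_app (corr_mat a0 R) b n)"

lemma hs_row_scale:
  assumes "a0 > 0" "hs_mem s y"
  shows "hs_mem s (\<lambda>n. row_scale a0 n * y n)"
    and "hs_sq s (\<lambda>n. row_scale a0 n * y n) \<le> (1 + (1 / a0)\<^sup>2) * hs_sq s y"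
    and "hs_sq s y \<le> (1 + a0\<^sup>2) * hs_sq s (\<lambda>n. row_scale a0 n * y n)"
proof -
  have le: "(row_scale a0 n * y n)\<^sup>2 \<le> (1 + (1 / a0)\<^sup>2) * (y n)\<^sup>2 + 0 * (y n)\<^sup>2" for n
    by (auto simp: row_scale_def power_mult_distrib distrib_right power_divide)
  show mem: "hs_mem s (\<lambda>n. row_scale a0 n * y n)"
    and "hs_sq s (\<lambda>n. row_scale a0 n * y n) \<le> (1 + (1 / a0)\<^sup>2) * hs_sq s y"
    using hs_dominated[OF assms(2,2) le] by auto
  have "(y n)\<^sup>2 \<le> (1 + a0\<^sup>2) * (row_scale a0 n * y n)\<^sup>2 + 0 * (row_scale a0 n * y n)\<^sup>2" for n
    using assms(1) by (auto simp: row_scale_def power_mult_distrib distrib_right power_divide)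
  from hs_dominated(2)[OF mem mem this]
  show "hs_sq s y \<le> (1 + a0\<^sup>2) * hs_sq s (\<lambda>n. row_scale a0 n * y n)" by simp
qed

lemma expansion_op_bounds:
  assumes "a0 > 0" "R > 2" "0 \<le> s"
  obtains C where "C > 0"
    "\<And>b. hs_mem s b \<Longrightarrow> hs_mem s (expansion_op a0 R b)"
    "\<And>b. hs_mem s b \<Longrightarrow> hs_sq s (expansion_op a0 R b) \<le> C * hs_sq s b"
    "\<And>b. hs_mem s b \<Longrightarrow> hs_sq s b \<le> C * hs_sq s (expansion_op a0 R b)"
proof -
  obtain w A B q \<theta> where M: "contraction_matrix (corr_mat a0 R) w A B q \<theta>"
    using corr_mat_contraction[OF assms(1,2)] .
  let ?y = "\<lambda>b n. b n + mat_app (corr_mat a0 R) b n"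
  obtain C where C: "C > 0" "\<And>a. hs_mem s a \<Longrightarrow> hs_mem s (?y a)"
      "\<And>a. hs_mem s a \<Longrightarrow> hs_sq s (?y a) \<le> C * hs_sq s a"
      "\<And>a. hs_mem s a \<Longrightarrow> hs_sq s a \<le> C * hs_sq s (?y a)"
    using contraction_matrix.hs_bounds[OF M assms(3)] by blast
  define K where "K = 1 + (1 / a0)\<^sup>2 + a0\<^sup>2"
  have op: "expansion_op a0 R b = (\<lambda>n. row_scale a0 n * ?y b n)" for b
    by (simp add: expansion_op_def fun_eq_iff)
  show thesis
  proof (rule that[of "K * C"])
    show "K * C > 0" using C(1) by (auto simp: K_def intro!: mult_pos_pos add_pos_nonneg)
    fix b assume b: "hs_mem s b"
    note y = C(2)[OF b] and rs = hs_row_scale[OF assms(1) C(2)[OF b]]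
    show mem: "hs_mem s (expansion_op a0 R b)"
      unfolding op by (rule rs(1))
    have "hs_sq s (expansion_op a0 R b) \<le> (1 + (1 / a0)\<^sup>2) * hs_sq s (?y b)"
      unfolding op by (rule rs(2))
    also have "\<dots> \<le> K * hs_sq s (?y b)"
      using hs_sq_nonneg[OF y] by (intro mult_right_mono) (auto simp: K_def)
    also have "\<dots> \<le> K * (C * hs_sq s b)"
      using C(3)[OF b] by (intro mult_left_mono) (auto simp: K_def)
    finally show "hs_sq s (expansion_op a0 R b) \<le> K * C * hs_sq s b" by simp
    have "hs_sq s (?y b) \<le> (1 + a0\<^sup>2) * hs_sq s (expansion_op a0 R b)"
      unfolding op by (rule rs(3))
    also have "\<dots> \<le> K * hs_sq s (expansion_op a0 R b)"
      using hs_sq_nonneg[OF mem] by (intro mult_right_mono) (auto simp: K_def)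
    finally have "C * hs_sq s (?y b) \<le> C * (K * hs_sq s (expansion_op a0 R b))"
      using C(1) by (intro mult_left_mono) auto
    with C(4)[OF b] show "hs_sq s b \<le> K * C * hs_sq s (expansion_op a0 R b)"
      by (simp add: mult_ac)
  qed
qed

lemma expansion_op_surj:
  assumes "a0 > 0" "R > 2" "0 \<le> s" "hs_mem s f"
  obtains b where "hs_mem s b" "expansion_op a0 R b = f"
proof -
  obtain w A B q \<theta> where M: "contraction_matrix (corr_mat a0 R) w A B q \<theta>"
    using corr_mat_contraction[OF assms(1,2)] .
  \<comment> \<open>\<open>row_scale (1 / a0)\<close> is the inverse of
    \<open>row_scale a0\<close>.\<close>
  define g where "g n = row_scale (1 / a0) n * f n" for n
  have "hs_mem s g"
    unfolding g_def[abs_def] using assms by (intro hs_row_scale(1)) auto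
  then obtain b where mem: "hs_mem s b" and b: "\<And>n. b n + mat_app (corr_mat a0 R) b n = g n"
    using contraction_matrix.hs_surj[OF M assms(3)] by blast
  have "expansion_op a0 R b = f"
    unfolding expansion_op_def b g_def using assms by (auto simp: row_scale_def fun_eq_iff)
  with mem show thesis by (rule that)
qed

lemma expansion_op_diff:
  assumes "a0 > 0" "R > 2" "0 \<le> s" "hs_mem s a" "hs_mem s b"
  shows "expansion_op a0 R (\<lambda>n. a n - b n) n = expansion_op a0 R a n - expansion_op a0 R b n"
proof -
  obtain w A B q \<theta> where M: "contraction_matrix (corr_mat a0 R) w A B q \<theta>"
    using corr_mat_contraction[OF assms(1,2)] .
  have "mat_app (corr_mat a0 R) (\<lambda>n. a n - b n) n = mat_app (corr_mat a0 R) a n - mat_app (corr_mat a0 R) b n"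
    by (rule contraction_matrix.mat_app_diff[OF M, of a "sqrt (hs_sq s a)" b "sqrt (hs_sq s b)"])
      (intro hs_abs_le assms)+
  then show ?thesis
    by (simp only: expansion_op_def) (simp add: right_diff_distrib distrib_left)
qed

text \<open>For finitely supported coefficients all series are finite sums, and the operator can be
  identified with the coefficients of an actual combination of the functions
  \<open>u_j\<close>.\<close>

lemma expansion_op_truncated:
  assumes "a0 > 0"
  shows "expansion_op a0 R (\<lambda>j. if j < N then a j else 0) n
    = (\<Sum>j<N. a j * ((if n = j then 1 else 0) + corr (alpha a0) R n j))"
proof -
  have "mat_app (corr_mat a0 R) (\<lambda>j. if j < N then a j else 0) n = (\<Sum>j<N. corr_mat a0 R n j * a j)"
    unfolding mat_app_def by (subst suminf_finite[of "{..<N}"]) auto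
  moreover have "(if n < N then a n else 0) = (\<Sum>j<N. a j * (if n = j then 1 else 0))"
    by (simp add: if_distrib[of "\<lambda>x. _ * x"] cong: if_cong)
  ultimately show ?thesis
    unfolding expansion_op_def expansion_matrix_eq[OF assms]
    by (simp add: sum_distrib_left sum.distrib[symmetric] algebra_simps)
qed

lemma hs_mem_finite_support: "hs_mem s (\<lambda>j. if j < N then a j else 0)"
  unfolding hs_mem_def by (rule summable_finite[of "{..<N}"]) auto

lemma hs_tail_tendsto_0:
  assumes "hs_mem s b"
  shows "(\<lambda>N. hs_sq s (\<lambda>n. b n - (if n < N then b n else 0))) \<longlonglongrightarrow> 0"
proof -
  let ?f = "\<lambda>n. (b n)\<^sup>2 * (1 + real n) powr (2 * s)"
  have sm: "summable ?f" using assms by (simp add: hs_mem_def)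
  have "hs_sq s (\<lambda>n. b n - (if n < N then b n else 0)) = suminf ?f - sum ?f {..<N}" for N
  proof -
    have "(\<lambda>n. ?f n - (if n \<in> {..<N} then ?f n else 0)) sums (suminf ?f - sum ?f {..<N})"
      by (intro sums_diff summable_sums sm sums_If_finite_set) auto
    also have "(\<lambda>n. ?f n - (if n \<in> {..<N} then ?f n else 0))
        = (\<lambda>n. (b n - (if n < N then b n else 0))\<^sup>2 * (1 + real n) powr (2 * s))"
      by auto
    finally show ?thesis unfolding hs_sq_def by (rule sums_unique[symmetric])
  qed
  moreover have "(\<lambda>N. suminf ?f - sum ?f {..<N}) \<longlonglongrightarrow> suminf ?f - suminf ?f"
    by (intro tendsto_intros summable_LIMSEQ sm)
  ultimately show ?thesis by simp
qed

section \<open>Functions on the circle and the expansion operator\<close>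

lemma refl_sym_linear:
  assumes "refl_sym R f" "refl_sym R g"
  shows "refl_sym R (\<lambda>z. f z - c * g z)"
  using assms unfolding refl_sym_def by eventually_elim simp

lemma
  assumes "a0 > 0" "R > 2"
  shows u_L2: "u a0 R j \<in> L2_circle R"
    and u_refl_sym: "refl_sym R (u a0 R j)"
    and u_cosine_coeff: "cosine_coeff R (u a0 R j) = (\<lambda>n. (if n = j then 1 else 0) + corr (alpha a0) R n j)"
proof -
  let ?c = "\<lambda>n. (if n = j then 1 else 0) + corr (alpha a0) R n j"
  have "(\<lambda>n. ?c n * cos (real n * (t - pi / 2))) sums u a0 R j (rcis R t)" for t
  proof -
    have "(\<lambda>n. if n = j then cos (real n * (t - pi / 2)) else 0) sums cos (real j * (t - pi / 2))"
      by (rule sums_single)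
    from sums_add[OF this u_cos_expansion[OF assms, of j t]]
    have "(\<lambda>n. (if n = j then cos (real n * (t - pi / 2)) else 0)
        + corr (alpha a0) R n j * cos (real n * (t - pi / 2))) sums u a0 R j (rcis R t)"
      by simp
    also have "(\<lambda>n. (if n = j then cos (real n * (t - pi / 2)) else 0)
        + corr (alpha a0) R n j * cos (real n * (t - pi / 2))) = (\<lambda>n. ?c n * cos (real n * (t - pi / 2)))"
      by (auto simp: distrib_right)
    finally show ?thesis .
  qed
  moreover have "summable (\<lambda>n. \<bar>?c n\<bar>)"
  proof (rule summable_comparison_test')
    let ?A = "2 * (\<bar>alpha a0\<bar> / (1 - \<bar>alpha a0\<bar>))"
    show "summable (\<lambda>n. (if n = j then 1 else 0) + ?A * (2 / R) ^ j * (2 / R) ^ n)"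
      using assms by (intro summable_add summable_mult summable_geometric sums_summable[OF sums_single]) auto
    show "norm \<bar>?c n\<bar> \<le> (if n = j then 1 else 0) + ?A * (2 / R) ^ j * (2 / R) ^ n" for n
      using abs_corr_le[OF abs_alpha_less_1[OF assms(1)], of R n j] assms
      by (auto simp: power_add mult_ac)
  qed
  ultimately show "u a0 R j \<in> L2_circle R" "refl_sym R (u a0 R j)" "cosine_coeff R (u a0 R j) = ?c"
    by (rule cosine_series_L2 cosine_series_sym cosine_series_coeff)+
qed

text \<open>The link between functions and sequences is needed for finite partial sums only, so
  linearity and induction on \<open>N\<close> suffice; limits are taken on the sequence
  side.\<close>

lemma truncation_remainder:
  fixes a :: "nat \<Rightarrow> real"
  assumes "a0 > 0" "R > 2" "f \<in> L2_circle R" "refl_sym R f"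
  defines "g \<equiv> \<lambda>N z. f z - (\<Sum>j<N. a j * u a0 R j z)"
  shows "g N \<in> L2_circle R" "refl_sym R (g N)"
    and "cosine_coeff R (g N) = (\<lambda>n. cosine_coeff R f n - expansion_op a0 R (\<lambda>j. if j < N then a j else 0) n)"
proof -
  have "g N \<in> L2_circle R \<and> refl_sym R (g N) \<and> (\<forall>n. cosine_coeff R (g N) n = cosine_coeff R f n
      - (\<Sum>j<N. a j * ((if n = j then 1 else 0) + corr (alpha a0) R n j)))"
  proof (induction N)
    case 0
    then show ?case using assms(3,4) by (simp add: g_def)
  next
    case (Suc N)
    have g: "g (Suc N) = (\<lambda>z. g N z - a N * u a0 R N z)"
      by (simp add: g_def fun_eq_iff)
    show ?case
      unfolding g using Suc assms(1,2)
      by (auto intro!: L2_circle_linear refl_sym_linear u_L2 u_refl_sym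
          simp: cosine_coeff_linear u_L2 u_cosine_coeff simp del: mult_1_right)
  qed
  then show "g N \<in> L2_circle R" "refl_sym R (g N)"
    and "cosine_coeff R (g N) = (\<lambda>n. cosine_coeff R f n - expansion_op a0 R (\<lambda>j. if j < N then a j else 0) n)"
    by (auto simp: expansion_op_truncated[OF assms(1)])
qed

lemma u_in_sobolev_sym:
  assumes "a0 > 0" "R > 2" "0 \<le> s"
  shows "u a0 R j \<in> sobolev_sym s R"
proof -
  obtain C where C: "\<And>b. hs_mem s b \<Longrightarrow> hs_mem s (expansion_op a0 R b)"
    using expansion_op_bounds[OF assms] by blast
  \<comment> \<open>The operator maps the unit vector to column \<open>j\<close>, so membership of
    \<open>u_j\<close> is an instance of its boundedness.\<close>
  let ?e = "\<lambda>i. if i = j then 1 else (0 :: real)"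
  have "expansion_op a0 R ?e = cosine_coeff R (u a0 R j)"
  proof
    fix n
    have "mat_app (corr_mat a0 R) ?e n = corr_mat a0 R n j"
      unfolding mat_app_def by (subst suminf_finite[of "{j}"]) auto
    then show "expansion_op a0 R ?e n = cosine_coeff R (u a0 R j) n"
      unfolding u_cosine_coeff[OF assms(1,2)] expansion_matrix_eq[OF assms(1)] expansion_op_def by simp
  qed
  moreover have "hs_mem s ?e"
    unfolding hs_mem_def by (rule summable_finite[of "{j}"]) auto
  ultimately have "hs_mem s (cosine_coeff R (u a0 R j))"
    using C by metis
  then show ?thesis
    using sobolev_sym_iff[OF u_L2[OF assms(1,2)] u_refl_sym[OF assms(1,2)], of s] assms by simp
qed

lemma sobolev_norm_nonneg: "0 \<le> R \<Longrightarrow> 0 \<le> sobolev_norm s R f"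
  unfolding sobolev_norm_def by (intro real_sqrt_ge_zero mult_nonneg_nonneg infsum_nonneg) auto

theorem proposition2p4:
  fixes a0 R0 s :: real
  assumes "a0 > 0" and "R0 > 2" and "s \<ge> 0"
  shows "schauder_basis (sobolev_sym s R0) (sobolev_norm s R0) (u a0 R0) \<and>
    (\<exists>C>0. \<forall>f \<in> sobolev_sym s R0. \<forall>a. expands_as (sobolev_norm s R0) (u a0 R0) f a \<longrightarrow>
       summable (\<lambda>j. (a j)\<^sup>2 * (1 + real j) powr (2 * s)) \<and>
       (\<Sum>j. (a j)\<^sup>2 * (1 + real j) powr (2 * s)) \<le> C * (sobolev_norm s R0 f)\<^sup>2)"
proof -
  let ?T = "expansion_op a0 R0"
  obtain C where C: "C > 0"
    "\<And>b. hs_mem s b \<Longrightarrow> hs_mem s (?T b)"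
    "\<And>b. hs_mem s b \<Longrightarrow> hs_sq s (?T b) \<le> C * hs_sq s b"
    "\<And>b. hs_mem s b \<Longrightarrow> hs_sq s b \<le> C * hs_sq s (?T b)"
    using expansion_op_bounds[OF assms] by blast
  define K where "K = 4 * (2 * R0\<^sup>2) powr s"
  have K: "K > 0" using assms by (simp add: K_def)
  have R: "1 \<le> R0" using assms by simp
  \<comment> \<open>If \<open>b\<close> is the preimage of the cosine coefficients of
    \<open>f\<close>, the \<open>N\<close>-th remainder of any candidate \<open>a\<close> has
    coefficients \<open>?T (b - tr a N)\<close>. The two-sided bounds make its Sobolev norm
    comparable to the weighted \<open>l^2\<close> norm of \<open>b - tr a N\<close>, which settles
    existence and uniqueness together.\<close>
  have main: "\<exists>b. hs_mem s b \<and> hs_sq s b \<le> C * K * (sobolev_norm s R0 f)\<^sup>2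
      \<and> (\<forall>a. expands_as (sobolev_norm s R0) (u a0 R0) f a \<longleftrightarrow> a = b)" if f: "f \<in> sobolev_sym s R0" for f
  proof -
    note fL = sobolev_symD[OF f]
    have f_mem: "hs_mem s (cosine_coeff R0 f)"
      using sobolev_sym_iff[OF fL R assms(3)] f by simp
    obtain b where b: "hs_mem s b" "?T b = cosine_coeff R0 f"
      using expansion_op_surj[OF assms f_mem] .
    have "hs_sq s b \<le> C * hs_sq s (cosine_coeff R0 f)"
      using C(4)[OF b(1)] b(2) by simp
    also have "\<dots> \<le> C * (K * (sobolev_norm s R0 f)\<^sup>2)"
      unfolding K_def using sobolev_norm_ge[OF fL R assms(3) f_mem] C(1) by (intro mult_left_mono) auto
    finally have bound: "hs_sq s b \<le> C * K * (sobolev_norm s R0 f)\<^sup>2" by simp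
    \<comment> \<open>A competing sequence \<open>a\<close> need not lie in the weighted space, but
      its truncations always do.\<close>
    define tr where "tr a N j = (if j < N then a j else (0::real))" for a N and j :: nat
    define g where "g a N z = f z - (\<Sum>j<N. a j * u a0 R0 j z)" for a N z
    have dmem: "hs_mem s (\<lambda>n. b n - tr a N n)" for a N
      unfolding tr_def[abs_def] by (intro hs_diff(1) b hs_mem_finite_support)
    have g_coeff: "cosine_coeff R0 (g a N) = ?T (\<lambda>n. b n - tr a N n)" for a N
    proof
      fix n
      show "cosine_coeff R0 (g a N) n = ?T (\<lambda>n. b n - tr a N n) n"
        using truncation_remainder(3)[OF assms(1,2) fL, where N = N and a = a]
          expansion_op_diff[OF assms b(1) hs_mem_finite_support[of s N a], of n] b(2)
        by (simp add: g_def[abs_def] tr_def[abs_def])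
    qed
    have g_mem: "hs_mem s (cosine_coeff R0 (g a N))" for a N
      unfolding g_coeff by (rule C(2)[OF dmem])
    have gL: "g a N \<in> L2_circle R0" "refl_sym R0 (g a N)" for a N
      using truncation_remainder(1,2)[OF assms(1,2) fL, where N = N and a = a] by (simp_all add: g_def[abs_def])
    have up: "(sobolev_norm s R0 (g a N))\<^sup>2 \<le> 4 * pi * R0 * (C * hs_sq s (\<lambda>n. b n - tr a N n))" for a N
    proof -
      have "(sobolev_norm s R0 (g a N))\<^sup>2 \<le> 4 * pi * R0 * hs_sq s (cosine_coeff R0 (g a N))"
        by (rule sobolev_norm_le[OF gL R assms(3) g_mem])
      also have "\<dots> \<le> 4 * pi * R0 * (C * hs_sq s (\<lambda>n. b n - tr a N n))"
        unfolding g_coeff using R by (intro mult_left_mono C(3) dmem) auto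
      finally show ?thesis .
    qed
    have low: "hs_sq s (\<lambda>n. b n - tr a N n) \<le> C * (K * (sobolev_norm s R0 (g a N))\<^sup>2)" for a N
    proof -
      have "hs_sq s (\<lambda>n. b n - tr a N n) \<le> C * hs_sq s (cosine_coeff R0 (g a N))"
        unfolding g_coeff by (rule C(4)[OF dmem])
      also have "\<dots> \<le> C * (K * (sobolev_norm s R0 (g a N))\<^sup>2)"
        unfolding K_def using sobolev_norm_ge[OF gL R assms(3) g_mem] C(1) by (intro mult_left_mono) auto
      finally show ?thesis .
    qed
    have exp_iff: "expands_as (sobolev_norm s R0) (u a0 R0) f a \<longleftrightarrow> (\<lambda>N. sobolev_norm s R0 (g a N)) \<longlonglongrightarrow> 0" for a
      by (simp add: expands_as_def g_def[abs_def])
    have conv: "(\<lambda>N. sobolev_norm s R0 (g b N)) \<longlonglongrightarrow> 0"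
    proof -
      have "(\<lambda>N. 4 * pi * R0 * (C * hs_sq s (\<lambda>n. b n - tr b N n))) \<longlonglongrightarrow> 4 * pi * R0 * (C * 0)"
        unfolding tr_def by (intro tendsto_mult_left hs_tail_tendsto_0 b)
      then have lim: "(\<lambda>N. 4 * pi * R0 * (C * hs_sq s (\<lambda>n. b n - tr b N n))) \<longlonglongrightarrow> 0"
        by simp
      have "(\<lambda>N. (sobolev_norm s R0 (g b N))\<^sup>2) \<longlonglongrightarrow> 0"
        by (rule Lim_null_comparison[OF _ lim]) (simp add: up)
      then have "(\<lambda>N. sqrt ((sobolev_norm s R0 (g b N))\<^sup>2)) \<longlonglongrightarrow> sqrt 0"
        by (rule tendsto_real_sqrt)
      then show ?thesis using sobolev_norm_nonneg[of R0] R by simp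
    qed
    have unique: "a = b" if lim: "(\<lambda>N. sobolev_norm s R0 (g a N)) \<longlonglongrightarrow> 0" for a
    proof
      fix j
      have "(\<lambda>N. C * (K * (sobolev_norm s R0 (g a N))\<^sup>2)) \<longlonglongrightarrow> C * (K * 0\<^sup>2)"
        by (intro tendsto_mult_left tendsto_power lim)
      \<comment> \<open>Once \<open>N > j\<close>, truncation leaves coordinate \<open>j\<close>
        untouched, so a fixed number is bounded by a sequence tending to 0.\<close>
      moreover have "(b j - a j)\<^sup>2 \<le> C * (K * (sobolev_norm s R0 (g a N))\<^sup>2)" if "N \<ge> Suc j" for N
      proof -
        have "\<bar>b j - a j\<bar> \<le> sqrt (hs_sq s (\<lambda>n. b n - tr a N n))"
          using hs_abs_le[OF assms(3) dmem[of a N], of j] that by (simp add: tr_def)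
        then have "(b j - a j)\<^sup>2 \<le> hs_sq s (\<lambda>n. b n - tr a N n)"
          by (rule sqrt_ge_absD)
        with low[of a N] show ?thesis by linarith
      qed
      ultimately have "(b j - a j)\<^sup>2 \<le> C * (K * 0\<^sup>2)"
        by (intro LIMSEQ_le_const exI[of _ "Suc j"]) auto
      then show "a j = b j" by simp
    qed
    have "expands_as (sobolev_norm s R0) (u a0 R0) f a \<longleftrightarrow> a = b" for a
      unfolding exp_iff
    proof
      show "a = b" if "(\<lambda>N. sobolev_norm s R0 (g a N)) \<longlonglongrightarrow> 0"
        by (rule unique[OF that])
      show "(\<lambda>N. sobolev_norm s R0 (g a N)) \<longlonglongrightarrow> 0" if "a = b"
        unfolding that by (rule conv)
    qed
    with b(1) bound show ?thesis by (intro exI[of _ b] conjI allI)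
  qed
  have "schauder_basis (sobolev_sym s R0) (sobolev_norm s R0) (u a0 R0)"
    unfolding schauder_basis_def
  proof (intro conjI allI ballI)
    show "u a0 R0 j \<in> sobolev_sym s R0" for j
      by (rule u_in_sobolev_sym[OF assms])
    show "\<exists>!a. expands_as (sobolev_norm s R0) (u a0 R0) f a" if "f \<in> sobolev_sym s R0" for f
      using main[OF that] by auto
  qed
  moreover have "C * K > 0" using C(1) K by simp
  moreover have "\<forall>f \<in> sobolev_sym s R0. \<forall>a. expands_as (sobolev_norm s R0) (u a0 R0) f a \<longrightarrow>
       summable (\<lambda>j. (a j)\<^sup>2 * (1 + real j) powr (2 * s)) \<and>
       (\<Sum>j. (a j)\<^sup>2 * (1 + real j) powr (2 * s)) \<le> C * K * (sobolev_norm s R0 f)\<^sup>2"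
  proof (intro ballI allI impI)
    fix f a assume f: "f \<in> sobolev_sym s R0" and "expands_as (sobolev_norm s R0) (u a0 R0) f a"
    with main[OF f] have "hs_mem s a" "hs_sq s a \<le> C * K * (sobolev_norm s R0 f)\<^sup>2" by auto
    then show "summable (\<lambda>j. (a j)\<^sup>2 * (1 + real j) powr (2 * s)) \<and>
       (\<Sum>j. (a j)\<^sup>2 * (1 + real j) powr (2 * s)) \<le> C * K * (sobolev_norm s R0 f)\<^sup>2"
      unfolding hs_mem_def hs_sq_def by (rule conjI)
  qed
  ultimately show ?thesis by (intro conjI exI[of _ "C * K"])
qed

end
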